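(* Let $\Omega=[a,b]$ with partition $a=x_0<x_1<\dots<x_m=b$, $\Omega_j=(x_{j-1},x_j)$, $m\ge 1$, and let $p,q,w$ be complex-valued functions on $\Omega$, extended periodically to $\mathbb{R}$ with period $\ell=b-a$. Assume: (1) for every $j\in\{1,\dots,m\}$: $p,w\in W^{2,\infty}(\Omega_j)$, $\inf_{x\in\overline{\Omega_j}}|p(x)|>0$ and $\inf_{x\in\overline{\Omega_j}}|w(x)|>0$; (2) $w/p=r^2$ on $\Omega$ for some $r:\Omega\to(0,\infty)$ (also extended $\ell$-periodically); (3) $q\in L^\infty(\Omega)$; (4) $(p\,r)(x_j^+)+(p\,r)(x_j^-)\neq 0$ for every $j\in\{1,\dots,m\}$. Let $\varphi\in\mathbb{R}$, and call $\lambda\in\mathbb{C}$ an eigenvalue if there is a nontrivial solution $y$ of $$-(p\,y')'+q\,y=\lambda\,w\,y\quad\text{on }\Omega$$ whose state vector $Y=(y,py')^{T}$ satisfies the pseudo-periodic boundary condition $Y(b^+)=e^{i\varphi}Y(a^+)$. Then the eigenvalues in the open left half-plane form a bounded set: there exists $R_0>0$ such that every eigenvalue $\lambda$ with $\operatorname{Re}(\lambda)<0$ satisfies $|\lambda|<R_0$.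
   Context: A solution of $-(py')'+qy=\lambda wy$ on $\Omega$ is a function $y$ with $y,\,py'\in AC(\Omega)$ (absolutely continuous on $[a,b]$) satisfying the equation almost everywhere on $\Omega$. The state vector $Y=(y,py')^T$ is therefore continuous across each interface, $Y(x_j^+)=Y(x_j^-)$ for $j=1,\dots,m$; in particular, at $x_m=b$, $Y(b^+)=Y(b^-)$, so the boundary condition $Y(b^+)=e^{i\varphi}Y(a^+)$ relates the value of $Y$ at $b$ to its value at $a$. $f(x^\pm)$ denotes the one-sided limits of $f$ at $x$. All interface values of $p,r$ and their derivatives are one-sided limits (these exist because $p,r\in W^{2,\infty}(\Omega_j)$). At $j=m$ the limit from the right is taken via the $\ell$-periodic extension, so $(pr)(x_m^+)=(pr)(a^+)$. $W^{2,\infty}(I)$ is the Sobolev space of functions on the open interval $I$ with weak derivatives up to order 2 in $L^\infty(I)$ (identified with their continuous representatives on $\overline I$). *)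

theory Defs
  imports "HOL-Analysis.Analysis"
begin

definition absolutely_continuous_on ::
    "real \<Rightarrow> real \<Rightarrow> (real \<Rightarrow> 'a::real_normed_vector) \<Rightarrow> bool" where
  "absolutely_continuous_on a b f \<longleftrightarrow>
     (\<forall>\<epsilon>>0. \<exists>\<delta>>0. \<forall>(n::nat) u v.
        (\<forall>i<n. a \<le> u i \<and> u i \<le> v i \<and> v i \<le> b) \<and>
        disjoint_family_on (\<lambda>i. {u i<..<v i}) {..<n} \<and>
        (\<Sum>i<n. v i - u i) < \<delta>
        \<longrightarrow> (\<Sum>i<n. norm (f (v i) - f (u i))) < \<epsilon>)"

definition Linf_on :: "real set \<Rightarrow> (real \<Rightarrow> complex) \<Rightarrow> bool" where
  "Linf_on S f \<longleftrightarrow>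
     f \<in> borel_measurable (lebesgue_on S) \<and> (\<exists>C. AE t in lebesgue_on S. cmod (f t) \<le> C)"

definition test_function_on :: "real set \<Rightarrow> (real \<Rightarrow> real) \<Rightarrow> bool" where
  "test_function_on I \<psi> \<longleftrightarrow>
     (\<forall>n t. (deriv ^^ n) \<psi> field_differentiable at t) \<and>
     (\<exists>K. compact K \<and> K \<subseteq> I \<and> (\<forall>t. t \<notin> K \<longrightarrow> \<psi> t = 0))"

definition weak_deriv_on ::
    "nat \<Rightarrow> real set \<Rightarrow> (real \<Rightarrow> complex) \<Rightarrow> (real \<Rightarrow> complex) \<Rightarrow> bool" where
  "weak_deriv_on k I f g \<longleftrightarrow>
     (\<forall>\<psi>. test_function_on I \<psi> \<longrightarrow>
        (LINT t|lebesgue_on I. f t * of_real ((deriv ^^ k) \<psi> t)) =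
        (- 1) ^ k * (LINT t|lebesgue_on I. g t * of_real (\<psi> t)))"

definition sobolev_inf_on :: "nat \<Rightarrow> real set \<Rightarrow> (real \<Rightarrow> complex) \<Rightarrow> bool" where
  "sobolev_inf_on k I f \<longleftrightarrow>
     Linf_on I f \<and> (\<forall>i\<in>{1..k}. \<exists>g. Linf_on I g \<and> weak_deriv_on i I f g)"

text \<open>The continuous representative on \<open>closure I\<close> of a function that is continuous
  on the open interval \<open>I\<close>: at an end point it is the one-sided limit from inside \<open>I\<close>, whatever
  the value of \<open>f\<close> there.\<close>

definition closure_rep :: "real set \<Rightarrow> (real \<Rightarrow> complex) \<Rightarrow> real \<Rightarrow> complex" where
  "closure_rep I f t = Lim (at t within I) f"

text \<open>The second component \<open>v\<close> is the absolutely continuous representative of \<open>p y'\<close>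
  (as \<open>y'\<close> exists only almost everywhere), so that \<open>(y, v)\<close> is the state vector. It is uniquely
  determined by \<open>y\<close>.\<close>

definition is_solution ::
    "real \<Rightarrow> real \<Rightarrow> (real \<Rightarrow> complex) \<Rightarrow> (real \<Rightarrow> complex) \<Rightarrow> (real \<Rightarrow> complex) \<Rightarrow> complex
      \<Rightarrow> (real \<Rightarrow> complex) \<Rightarrow> (real \<Rightarrow> complex) \<Rightarrow> bool" where
  "is_solution a b p q w \<mu> y v \<longleftrightarrow>
     absolutely_continuous_on a b y \<and> absolutely_continuous_on a b v \<and>
     (AE t in lebesgue_on {a..b}. \<exists>y' v'.
        (y has_vector_derivative y') (at t) \<and> v t = p t * y' \<and>
        (v has_vector_derivative v') (at t) \<and> - v' + q t * y t = \<mu> * w t * y t)"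

text \<open>The state vector is continuous across every interface, including \<open>b\<close>, so its one-sided limits
  \<open>Y(b+)\<close> and \<open>Y(a+)\<close> in the boundary condition are its values at \<open>b\<close> and \<open>a\<close>.\<close>

definition is_eigenvalue ::
    "real \<Rightarrow> real \<Rightarrow> (real \<Rightarrow> complex) \<Rightarrow> (real \<Rightarrow> complex) \<Rightarrow> (real \<Rightarrow> complex) \<Rightarrow> real
      \<Rightarrow> complex \<Rightarrow> bool" where
  "is_eigenvalue a b p q w \<phi> \<mu> \<longleftrightarrow>
     (\<exists>y v. is_solution a b p q w \<mu> y v \<and> (\<exists>t\<in>{a..b}. y t \<noteq> 0) \<and>
        y b = exp (\<i> * of_real \<phi>) * y a \<and> v b = exp (\<i> * of_real \<phi>) * v a)"

end

theory Submission
  imports Defs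
begin

text \<open>
  Put \<open>k = sqrt (- \<mu>)\<close> with \<open>Re k > 0\<close>. For \<open>Re \<mu> < 0\<close> the argument of \<open>- \<mu>\<close> is less than \<open>\<pi> / 2\<close> in absolute value, so
  \<open>Re k\<close> is at least a fixed multiple of \<open>\<bar>k\<bar>\<close>, and it suffices to exclude eigenvalues with large \<open>Re k\<close>.

  On each piece of the partition let \<open>s = p r\<close>, the square root of \<open>p w\<close>, and decompose the state \<open>(y, v)\<close>, \<open>v = p y'\<close>,
  into the modes \<open>U = v + k s y\<close> and \<open>V = v - k s y\<close>. They satisfy
  \<open>U' = k r U + (q + k s') y\<close> and \<open>V' = - k r V + (q - k s') y\<close>, and since \<open>2 k s y = U - V\<close>, the last terms are
  bounded perturbations: \<open>U\<close> grows and \<open>V\<close> decays exponentially, at rate \<open>Re k\<close>. At an interface where \<open>s\<close> jumps from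
  \<open>s1\<close> to \<open>s2\<close> the modes are mixed, and the hypothesis \<open>s1 + s2 \<noteq> 0\<close> says that the growing mode
  is not annihilated.

  Both effects are measured by the quadratic form \<open>\<bar>U\<bar>\<^sup>2 - K \<bar>V\<bar>\<^sup>2\<close>. Take a small weight \<open>K\<close> at the left end of a piece
  and let it increase to a large one at the right end. Behind an interface this energy is at least a fixed positive
  multiple of what it is in front (\<open>energy_interface\<close>), whereas along a piece its derivative is at least \<open>Re k r0\<close> times its absolute value
  (\<open>energy_on_piece\<close>). Thus for large \<open>Re k\<close> one step, consisting of an interface and the following piece, at least doubles a
  positive energy and at least halves the size of a negative one (\<open>energy_step\<close>). The pseudo-periodic condition makes
  the energy return to its initial value after a full period, so it is zero at all partition points
  (\<open>cyclic_growth_imp_zero\<close>); then it is zero throughout, and strict growth leaves only the trivial solution.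

  The derivative \<open>s'\<close> is needed only as a bound. It is therefore enough that \<open>s\<close> is Lipschitz, which follows from the
  boundedness of the first weak derivatives of the coefficients by testing with smoothed indicator functions
  (\<open>weak_deriv_imp_lipschitz\<close>). Derivatives of expressions containing \<open>s\<close> are handled up to a tolerance
  (\<open>approx_deriv\<close>), and the resulting differential inequality is integrated by a mean value theorem for absolutely
  continuous functions (\<open>absolutely_continuous_mean_value\<close>).
\<close>

section \<open>Derivatives up to a tolerance\<close>

text \<open>The filter of pairs \<open>u \<le> t \<le> v\<close> shrinking to \<open>t\<close>. Increments \<open>f v - f u\<close> over such pairs, instead of
quotients based at \<open>t\<close> itself, are what a tagged division of an interval produces.\<close>

definition straddle :: "real \<Rightarrow> (real \<times> real) filter" where
  "straddle t = inf (nhds t \<times>\<^sub>F nhds t) (principal {(u, v). u \<le> t \<and> t \<le> v})"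

text \<open>Differentiability up to a tolerance \<open>B\<close> in the slope. A differentiable function has tolerance \<open>0\<close>,
and a Lipschitz function has slope \<open>0\<close> at every point with its Lipschitz constant as tolerance. The proof only needs bounds for derivatives, and the calculus below gives such bounds for
products of differentiable and Lipschitz functions without the theorem that Lipschitz functions are
differentiable almost everywhere.\<close>

definition approx_deriv :: "(real \<Rightarrow> 'a::real_normed_vector) \<Rightarrow> real \<Rightarrow> 'a \<Rightarrow> real \<Rightarrow> bool" where
  "approx_deriv f t D B \<longleftrightarrow>
     (\<forall>e>0. \<forall>\<^sub>F (u, v) in straddle t. norm (f v - f u - (v - u) *\<^sub>R D) \<le> (B + e) * (v - u))"

lemma approx_derivI:
  assumes "\<And>e. e > 0 \<Longrightarrow> \<forall>\<^sub>F z in straddle t.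
     norm (f (snd z) - f (fst z) - (snd z - fst z) *\<^sub>R D) \<le> (B + e) * (snd z - fst z)"
  shows "approx_deriv f t D B"
  using assms by (auto simp: approx_deriv_def split_def)

lemma approx_derivD:
  assumes "approx_deriv f t D B" "e > 0"
  shows "\<forall>\<^sub>F z in straddle t.
     norm (f (snd z) - f (fst z) - (snd z - fst z) *\<^sub>R D) \<le> (B + e) * (snd z - fst z)"
  using assms by (auto simp: approx_deriv_def split_def)

lemma straddle_order: "\<forall>\<^sub>F z in straddle t. fst z \<le> t \<and> t \<le> snd z"
  unfolding straddle_def eventually_inf_principal by (rule always_eventually) auto

lemma straddle_fst: "filterlim fst (nhds t) (straddle t)"
  unfolding straddle_def by (rule filterlim_mono[OF filterlim_fst order_refl inf.cobounded1])

lemma straddle_snd: "filterlim snd (nhds t) (straddle t)"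
  unfolding straddle_def by (rule filterlim_mono[OF filterlim_snd order_refl inf.cobounded1])

lemma eventually_straddle:
  assumes "eventually P (straddle t)"
  obtains d where "d > 0" "\<And>u v. \<lbrakk>t - d < u; u \<le> t; t \<le> v; v < t + d\<rbrakk> \<Longrightarrow> P (u, v)"
proof -
  from assms have "\<forall>\<^sub>F z in nhds t \<times>\<^sub>F nhds t. z \<in> {(u, v). u \<le> t \<and> t \<le> v} \<longrightarrow> P z"
    unfolding straddle_def by (simp add: eventually_inf_principal)
  then have "\<forall>\<^sub>F z in nhds (t, t). z \<in> {(u, v). u \<le> t \<and> t \<le> v} \<longrightarrow> P z"
    by (simp add: nhds_prod)
  then obtain e where e: "e > 0" "\<And>z. dist z (t, t) < e \<Longrightarrow> z \<in> {(u, v). u \<le> t \<and> t \<le> v} \<longrightarrow> P z"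
    unfolding eventually_nhds_metric by blast
  show thesis
  proof (rule that[of "e / 2"])
    fix u v assume uv: "t - e / 2 < u" "u \<le> t" "t \<le> v" "v < t + e / 2"
    have "dist (u, v) (t, t) \<le> dist u t + dist v t"
      unfolding dist_prod_def by (simp add: sqrt_sum_squares_le_sum)
    also have "\<dots> < e" using uv by (simp add: dist_real_def)
    finally show "P (u, v)" using e(2) uv by auto
  qed (use e in auto)
qed

text \<open>The pairs \<open>(x, t)\<close> or \<open>(t, x)\<close> straddle \<open>t\<close>, so increments at \<open>t\<close> are at most a multiple of
\<open>\<bar>x - t\<bar>\<close>.\<close>

lemma approx_deriv_isCont:
  assumes "approx_deriv f t D B"
  shows "isCont f t"
proof -
  obtain d where d: "d > 0"
    "\<And>u v. \<lbrakk>t - d < u; u \<le> t; t \<le> v; v < t + d\<rbrakk> \<Longrightarrow> norm (f v - f u - (v - u) *\<^sub>R D) \<le> (B + 1) * (v - u)"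
    using eventually_straddle[OF approx_derivD[OF assms, of 1]] by auto
  have bound: "norm (f x - f t) \<le> (\<bar>B\<bar> + 1 + norm D) * \<bar>x - t\<bar>" if "dist x t < d" for x
  proof (cases "x \<le> t")
    case True
    have "norm (f t - f x) \<le> norm (f t - f x - (t - x) *\<^sub>R D) + norm ((t - x) *\<^sub>R D)"
      by (metis norm_triangle_ineq diff_add_cancel)
    also have "\<dots> \<le> (B + 1) * (t - x) + (t - x) * norm D"
      using d(2)[of x t] True that d(1) by (auto simp: dist_real_def)
    also have "\<dots> \<le> (\<bar>B\<bar> + 1 + norm D) * \<bar>x - t\<bar>"
      using True mult_right_mono[of B "\<bar>B\<bar>" "t - x"] by (simp add: algebra_simps)
    finally show ?thesis by (simp add: norm_minus_commute)
  next
    case False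
    have "norm (f x - f t) \<le> norm (f x - f t - (x - t) *\<^sub>R D) + norm ((x - t) *\<^sub>R D)"
      by (metis norm_triangle_ineq diff_add_cancel)
    also have "\<dots> \<le> (B + 1) * (x - t) + (x - t) * norm D"
      using d(2)[of t x] False that d(1) by (auto simp: dist_real_def)
    also have "\<dots> \<le> (\<bar>B\<bar> + 1 + norm D) * \<bar>x - t\<bar>"
      using False mult_right_mono[of B "\<bar>B\<bar>" "x - t"] by (simp add: algebra_simps)
    finally show ?thesis .
  qed
  have "((\<lambda>x. f x - f t) \<longlongrightarrow> 0) (at t)"
  proof (rule Lim_null_comparison)
    show "\<forall>\<^sub>F x in at t. norm (f x - f t) \<le> (\<bar>B\<bar> + 1 + norm D) * \<bar>x - t\<bar>"
      unfolding eventually_at using bound d(1) by blast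
    show "((\<lambda>x. (\<bar>B\<bar> + 1 + norm D) * \<bar>x - t\<bar>) \<longlongrightarrow> 0) (at t)"
      by (rule tendsto_eq_intros refl | simp)+
  qed
  then show ?thesis by (simp add: isCont_def LIM_zero_iff)
qed

lemma has_vector_derivative_imp_approx_deriv:
  assumes "(f has_vector_derivative D) (at t)"
  shows "approx_deriv f t D 0"
proof (rule approx_derivI)
  fix e :: real assume e: "e > 0"
  from assms have "\<forall>e>0. \<exists>d>0. \<forall>y. norm (y - t) < d \<longrightarrow>
      norm (f y - f t - (y - t) *\<^sub>R D) \<le> e * norm (y - t)"
    unfolding has_vector_derivative_def has_derivative_at_alt by auto
  then obtain d where d: "d > 0"
    "\<And>y. norm (y - t) < d \<Longrightarrow> norm (f y - f t - (y - t) *\<^sub>R D) \<le> e * norm (y - t)"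
    using e by blast
  have near: "\<forall>\<^sub>F z in straddle t. norm (fst z - t) < d" "\<forall>\<^sub>F z in straddle t. norm (snd z - t) < d"
    using tendstoD[OF straddle_fst d(1)] tendstoD[OF straddle_snd d(1)] by (auto simp: dist_norm)
  show "\<forall>\<^sub>F z in straddle t. norm (f (snd z) - f (fst z) - (snd z - fst z) *\<^sub>R D) \<le> (0 + e) * (snd z - fst z)"
    using near straddle_order
  proof eventually_elim
    case (elim z)
    have "norm (f (snd z) - f (fst z) - (snd z - fst z) *\<^sub>R D)
      = norm ((f (snd z) - f t - (snd z - t) *\<^sub>R D) - (f (fst z) - f t - (fst z - t) *\<^sub>R D))"
      by (simp add: algebra_simps)
    also have "\<dots> \<le> e * norm (snd z - t) + e * norm (fst z - t)"
      using norm_triangle_ineq4 d(2) elim by (meson add_mono order_trans)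
    also have "\<dots> = (0 + e) * (snd z - fst z)"
      using elim by (simp add: algebra_simps)
    finally show ?case .
  qed
qed

lemma lipschitz_imp_approx_deriv:
  assumes "L-lipschitz_on {c..d} f" "c < t" "t < d"
  shows "approx_deriv f t 0 L"
proof (rule approx_derivI)
  fix e :: real assume e: "e > 0"
  have "\<forall>\<^sub>F z in straddle t. fst z > c" "\<forall>\<^sub>F z in straddle t. snd z < d"
    using order_tendstoD(1)[OF straddle_fst assms(2)] order_tendstoD(2)[OF straddle_snd assms(3)] by auto
  then show "\<forall>\<^sub>F z in straddle t. norm (f (snd z) - f (fst z) - (snd z - fst z) *\<^sub>R 0) \<le> (L + e) * (snd z - fst z)"
    using straddle_order
  proof eventually_elim
    case (elim z)
    then have "norm (f (snd z) - f (fst z)) \<le> L * \<bar>snd z - fst z\<bar>"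
      using lipschitz_onD[OF assms(1), of "snd z" "fst z"] by (simp add: dist_norm)
    also have "\<dots> \<le> (L + e) * (snd z - fst z)"
      using elim e by (simp add: algebra_simps mult_left_mono)
    finally show ?case by simp
  qed
qed

lemma approx_deriv_add:
  assumes "approx_deriv f t D B" "approx_deriv g t E C"
  shows "approx_deriv (\<lambda>x. f x + g x) t (D + E) (B + C)"
proof (rule approx_derivI)
  fix e :: real assume e: "e > 0"
  then have "e / 2 > 0" by simp
  from approx_derivD[OF assms(1) this] approx_derivD[OF assms(2) this]
  show "\<forall>\<^sub>F z in straddle t. norm (f (snd z) + g (snd z) - (f (fst z) + g (fst z)) - (snd z - fst z) *\<^sub>R (D + E))
     \<le> (B + C + e) * (snd z - fst z)"
  proof eventually_elim
    case (elim z)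
    have "norm (f (snd z) + g (snd z) - (f (fst z) + g (fst z)) - (snd z - fst z) *\<^sub>R (D + E)) =
      norm ((f (snd z) - f (fst z) - (snd z - fst z) *\<^sub>R D) + (g (snd z) - g (fst z) - (snd z - fst z) *\<^sub>R E))"
      by (simp add: algebra_simps)
    also have "\<dots> \<le> (B + e/2) * (snd z - fst z) + (C + e/2) * (snd z - fst z)"
      using norm_triangle_mono elim by blast
    finally show ?case by (simp add: algebra_simps)
  qed
qed

lemma approx_deriv_minus:
  assumes "approx_deriv f t D B"
  shows "approx_deriv (\<lambda>x. - f x) t (- D) B"
proof (rule approx_derivI)
  fix e :: real assume e: "e > 0"
  from approx_derivD[OF assms this]
  show "\<forall>\<^sub>F z in straddle t. norm (- f (snd z) - - f (fst z) - (snd z - fst z) *\<^sub>R (- D)) \<le> (B + e) * (snd z - fst z)"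
  proof eventually_elim
    case (elim z)
    have eq: "- f (snd z) - - f (fst z) - (snd z - fst z) *\<^sub>R (- D) = - (f (snd z) - f (fst z) - (snd z - fst z) *\<^sub>R D)"
      by (simp add: algebra_simps)
    show ?case unfolding eq norm_minus_cancel by (rule elim)
  qed
qed

lemma approx_deriv_diff:
  assumes "approx_deriv f t D B" "approx_deriv g t E C"
  shows "approx_deriv (\<lambda>x. f x - g x) t (D - E) (B + C)"
  using approx_deriv_add[OF assms(1) approx_deriv_minus[OF assms(2)]] by simp

text \<open>The usual product rule. Besides the two tolerances, weighted by the other factor, only terms
with \<open>g v - g t\<close> or \<open>f u - f t\<close> appear, and these vanish in the limit by continuity.\<close>

lemma approx_deriv_bilinear:
  fixes mul :: "'a::real_normed_vector \<Rightarrow> 'b::real_normed_vector \<Rightarrow> 'c::real_normed_vector"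
  assumes bil: "bounded_bilinear mul"
    and prod1: "\<And>x y. norm (mul x y) \<le> norm x * norm y"
    and f: "approx_deriv f t D B" and g: "approx_deriv g t E C"
  shows "approx_deriv (\<lambda>x. mul (f x) (g x)) t (mul D (g t) + mul (f t) E)
           (B * norm (g t) + norm (f t) * C)"
proof (rule approx_derivI)
  interpret bounded_bilinear mul by fact
  fix e :: real assume e: "e > 0"
  \<comment> \<open>the two factors' tolerances are increased by \<open>e'\<close>, which costs \<open>e' (norm (f t) + norm (g t)) < e\<close>\<close>
  define e' where "e' = e / (norm (f t) + norm (g t) + 1)"
  have pos: "norm (f t) + norm (g t) + 1 > 0" by (smt (verit) norm_ge_zero)
  then have e': "e' > 0" using e by (simp add: e'_def)
  define W where "W z = (B + e') * norm (g (snd z)) + norm D * norm (g (snd z) - g t)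
      + norm (f (fst z)) * (C + e') + norm (f (fst z) - f t) * norm E" for z
  have cf: "((\<lambda>z. f (fst z)) \<longlongrightarrow> f t) (straddle t)"
    by (rule isCont_tendsto_compose[OF approx_deriv_isCont[OF f] straddle_fst])
  have cg: "((\<lambda>z. g (snd z)) \<longlongrightarrow> g t) (straddle t)"
    by (rule isCont_tendsto_compose[OF approx_deriv_isCont[OF g] straddle_snd])
  have "(W \<longlongrightarrow> (B + e') * norm (g t) + norm D * norm (g t - g t)
      + norm (f t) * (C + e') + norm (f t - f t) * norm E) (straddle t)"
    unfolding W_def by (intro tendsto_intros cf cg)
  moreover have "(B + e') * norm (g t) + norm D * norm (g t - g t)
      + norm (f t) * (C + e') + norm (f t - f t) * norm E < B * norm (g t) + norm (f t) * C + e"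
  proof -
    have "e' * (norm (f t) + norm (g t)) < e' * (norm (f t) + norm (g t) + 1)"
      using e' by simp
    also have "\<dots> = e" using pos by (simp add: e'_def)
    finally show ?thesis by (simp add: algebra_simps)
  qed
  ultimately have "\<forall>\<^sub>F z in straddle t. W z < B * norm (g t) + norm (f t) * C + e"
    by (rule order_tendstoD)
  with approx_derivD[OF f e'] approx_derivD[OF g e'] straddle_order
  show "\<forall>\<^sub>F z in straddle t. norm (mul (f (snd z)) (g (snd z)) - mul (f (fst z)) (g (fst z))
      - (snd z - fst z) *\<^sub>R (mul D (g t) + mul (f t) E))
     \<le> (B * norm (g t) + norm (f t) * C + e) * (snd z - fst z)"
  proof eventually_elim
    case (elim z)
    let ?h = "snd z - fst z"
    let ?F = "f (snd z) - f (fst z) - ?h *\<^sub>R D" and ?G = "g (snd z) - g (fst z) - ?h *\<^sub>R E"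
    have h: "?h \<ge> 0" using elim by simp
    have tri4: "norm (a + b + (a' + b')) \<le> norm a + norm b + (norm a' + norm b')" for a b a' b' :: 'c
      using norm_triangle_ineq[of "a + b" "a' + b'"] norm_triangle_ineq[of a b] norm_triangle_ineq[of a' b']
      by linarith
    let ?X = "mul (f (snd z)) (g (snd z)) - mul (f (fst z)) (g (fst z)) - ?h *\<^sub>R (mul D (g t) + mul (f t) E)"
    have split: "?X = mul ?F (g (snd z)) + mul (?h *\<^sub>R D) (g (snd z) - g t)
        + (mul (f (fst z)) ?G + mul (f (fst z) - f t) (?h *\<^sub>R E))"
      by (simp add: diff_left diff_right add_left add_right scaleR_left scaleR_right algebra_simps)
    have "norm ?X \<le> norm (mul ?F (g (snd z))) + norm (mul (?h *\<^sub>R D) (g (snd z) - g t))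
       + (norm (mul (f (fst z)) ?G) + norm (mul (f (fst z) - f t) (?h *\<^sub>R E)))"
      unfolding split by (rule tri4)
    also have "\<dots> \<le> norm ?F * norm (g (snd z)) + norm (?h *\<^sub>R D) * norm (g (snd z) - g t)
       + (norm (f (fst z)) * norm ?G + norm (f (fst z) - f t) * norm (?h *\<^sub>R E))"
      by (intro add_mono prod1)
    also have "\<dots> \<le> ((B + e') * ?h) * norm (g (snd z)) + (?h * norm D) * norm (g (snd z) - g t)
       + (norm (f (fst z)) * ((C + e') * ?h) + norm (f (fst z) - f t) * (?h * norm E))"
      using elim h by (intro add_mono mult_right_mono mult_left_mono) auto
    also have "\<dots> = W z * ?h" by (simp add: W_def algebra_simps)
    also have "\<dots> \<le> (B * norm (g t) + norm (f t) * C + e) * ?h"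
      using elim h by (intro mult_right_mono) auto
    finally show ?case .
  qed
qed

section \<open>Absolutely continuous functions\<close>

lemma absolutely_continuous_onE:
  assumes "absolutely_continuous_on a b f" "\<epsilon> > 0"
  obtains \<delta> where "\<delta> > 0" "\<And>(n::nat) u v. \<lbrakk>\<forall>i<n. a \<le> u i \<and> u i \<le> v i \<and> v i \<le> b;
        disjoint_family_on (\<lambda>i. {u i<..<v i}) {..<n}; (\<Sum>i<n. v i - u i) < \<delta>\<rbrakk>
         \<Longrightarrow> (\<Sum>i<n. norm (f (v i) - f (u i))) < \<epsilon>"
proof -
  from assms obtain \<delta> where "\<delta> > 0" and \<delta>: "\<forall>(n::nat) u v.
        (\<forall>i<n. a \<le> u i \<and> u i \<le> v i \<and> v i \<le> b) \<and>
        disjoint_family_on (\<lambda>i. {u i<..<v i}) {..<n} \<and>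
        (\<Sum>i<n. v i - u i) < \<delta> \<longrightarrow> (\<Sum>i<n. norm (f (v i) - f (u i))) < \<epsilon>"
    unfolding absolutely_continuous_on_def by blast
  show thesis by (rule that[OF \<open>\<delta> > 0\<close>]) (use \<delta> in blast)
qed

lemma absolutely_continuous_on_subset:
  assumes "absolutely_continuous_on a b f" "a \<le> c" "d \<le> b"
  shows "absolutely_continuous_on c d f"
  unfolding absolutely_continuous_on_def
proof (intro allI impI)
  fix \<epsilon> :: real assume \<epsilon>: "\<epsilon> > 0"
  obtain \<delta> where "\<delta> > 0" and \<delta>: "\<And>(n::nat) u v. \<lbrakk>\<forall>i<n. a \<le> u i \<and> u i \<le> v i \<and> v i \<le> b;
        disjoint_family_on (\<lambda>i. {u i<..<v i}) {..<n}; (\<Sum>i<n. v i - u i) < \<delta>\<rbrakk>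
         \<Longrightarrow> (\<Sum>i<n. norm (f (v i) - f (u i))) < \<epsilon>"
    by (rule absolutely_continuous_onE[OF assms(1) \<epsilon>]) (rule that; blast)
  show "\<exists>\<delta>>0. \<forall>(n::nat) u v.
        (\<forall>i<n. c \<le> u i \<and> u i \<le> v i \<and> v i \<le> d) \<and>
        disjoint_family_on (\<lambda>i. {u i<..<v i}) {..<n} \<and>
        (\<Sum>i<n. v i - u i) < \<delta> \<longrightarrow> (\<Sum>i<n. norm (f (v i) - f (u i))) < \<epsilon>"
  proof (intro exI conjI allI impI; (elim conjE)?)
    show "\<delta> > 0" by fact
    fix n :: nat and u v :: "nat \<Rightarrow> real"
    assume H: "\<forall>i<n. c \<le> u i \<and> u i \<le> v i \<and> v i \<le> d"
        "disjoint_family_on (\<lambda>i. {u i<..<v i}) {..<n}" "(\<Sum>i<n. v i - u i) < \<delta>"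
    have "\<forall>i<n. a \<le> u i \<and> u i \<le> v i \<and> v i \<le> b"
      using H(1) assms(2,3) by (meson order_trans)
    then show "(\<Sum>i<n. norm (f (v i) - f (u i))) < \<epsilon>" using \<delta> H(2,3) by blast
  qed
qed

text \<open>Closure under sums, differences and bounded products follows from this domination principle.\<close>

lemma absolutely_continuous_on_dominated:
  assumes f: "absolutely_continuous_on a b f" and g: "absolutely_continuous_on a b g"
    and M: "\<And>u v. \<lbrakk>u \<in> {a..b}; v \<in> {a..b}\<rbrakk> \<Longrightarrow>
      norm (h v - h u) \<le> M * (norm (f v - f u) + norm (g v - g u))"
  shows "absolutely_continuous_on a b h"
  unfolding absolutely_continuous_on_def
proof (intro allI impI)
  fix \<epsilon> :: real assume \<epsilon>: "\<epsilon> > 0"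
  define e where "e = \<epsilon> / (2 * (\<bar>M\<bar> + 1))"
  have e: "e > 0" using \<epsilon> unfolding e_def by (intro divide_pos_pos) (auto intro: add_nonneg_pos)
  obtain \<delta>1 where 1: "\<delta>1 > 0" "\<And>(n::nat) u v. \<lbrakk>\<forall>i<n. a \<le> u i \<and> u i \<le> v i \<and> v i \<le> b;
        disjoint_family_on (\<lambda>i. {u i<..<v i}) {..<n}; (\<Sum>i<n. v i - u i) < \<delta>1\<rbrakk>
         \<Longrightarrow> (\<Sum>i<n. norm (f (v i) - f (u i))) < e"
    by (rule absolutely_continuous_onE[OF f e]) (rule that; blast)
  obtain \<delta>2 where 2: "\<delta>2 > 0" "\<And>(n::nat) u v. \<lbrakk>\<forall>i<n. a \<le> u i \<and> u i \<le> v i \<and> v i \<le> b;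
        disjoint_family_on (\<lambda>i. {u i<..<v i}) {..<n}; (\<Sum>i<n. v i - u i) < \<delta>2\<rbrakk>
         \<Longrightarrow> (\<Sum>i<n. norm (g (v i) - g (u i))) < e"
    by (rule absolutely_continuous_onE[OF g e]) (rule that; blast)
  show "\<exists>\<delta>>0. \<forall>(n::nat) u v.
        (\<forall>i<n. a \<le> u i \<and> u i \<le> v i \<and> v i \<le> b) \<and>
        disjoint_family_on (\<lambda>i. {u i<..<v i}) {..<n} \<and>
        (\<Sum>i<n. v i - u i) < \<delta> \<longrightarrow> (\<Sum>i<n. norm (h (v i) - h (u i))) < \<epsilon>"
  proof (intro exI conjI allI impI; (elim conjE)?)
    show "min \<delta>1 \<delta>2 > 0" using 1 2 by simp
    fix n :: nat and u v :: "nat \<Rightarrow> real"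
    assume H: "\<forall>i<n. a \<le> u i \<and> u i \<le> v i \<and> v i \<le> b"
        "disjoint_family_on (\<lambda>i. {u i<..<v i}) {..<n}" "(\<Sum>i<n. v i - u i) < min \<delta>1 \<delta>2"
    have "(\<Sum>i<n. norm (h (v i) - h (u i)))
        \<le> (\<Sum>i<n. (\<bar>M\<bar> + 1) * (norm (f (v i) - f (u i)) + norm (g (v i) - g (u i))))"
    proof (rule sum_mono)
      fix i assume i: "i \<in> {..<n}"
      then have "u i \<in> {a..b}" "v i \<in> {a..b}" using H(1) by force+
      from M[OF this] show "norm (h (v i) - h (u i)) \<le> (\<bar>M\<bar> + 1) * (norm (f (v i) - f (u i)) + norm (g (v i) - g (u i)))"
        by (rule order_trans) (intro mult_right_mono; simp)
    qed
    also have "\<dots> = (\<bar>M\<bar> + 1) * ((\<Sum>i<n. norm (f (v i) - f (u i))) + (\<Sum>i<n. norm (g (v i) - g (u i))))"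
      by (simp only: sum_distrib_left[symmetric] sum.distrib)
    also have "\<dots> < (\<bar>M\<bar> + 1) * (e + e)"
      using 1(2)[of n u v] 2(2)[of n u v] H by (intro mult_strict_left_mono add_strict_mono) auto
    also have "\<dots> = \<epsilon>"
    proof -
      have "\<bar>M\<bar> + 1 > 0" by (intro add_nonneg_pos) auto
      then have "2 * (\<bar>M\<bar> + 1) \<noteq> 0" by (metis less_irrefl mult_pos_pos zero_less_numeral)
      moreover have "(\<bar>M\<bar> + 1) * (e + e) = (2 * (\<bar>M\<bar> + 1)) * e" by (simp add: algebra_simps)
      ultimately show ?thesis unfolding e_def times_divide_eq_right by (metis nonzero_mult_div_cancel_left)
    qed
    finally show "(\<Sum>i<n. norm (h (v i) - h (u i))) < \<epsilon>" .
  qed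
qed

lemma absolutely_continuous_on_ident: "absolutely_continuous_on a b (\<lambda>t::real. t)"
  unfolding absolutely_continuous_on_def
proof (intro allI impI)
  fix \<epsilon> :: real assume "\<epsilon> > 0"
  have eq: "(\<Sum>i<n. norm (v i - u i)) = (\<Sum>i<n. v i - u i)"
    if "\<forall>i<n. a \<le> u i \<and> u i \<le> v i \<and> v i \<le> b" for n :: nat and u v :: "nat \<Rightarrow> real"
    using that by (intro sum.cong) auto
  show "\<exists>\<delta>>0. \<forall>(n::nat) u v.
        (\<forall>i<n. a \<le> u i \<and> u i \<le> v i \<and> v i \<le> b) \<and>
        disjoint_family_on (\<lambda>i. {u i<..<v i}) {..<n} \<and>
        (\<Sum>i<n. v i - u i) < \<delta> \<longrightarrow> (\<Sum>i<n. norm (v i - u i)) < \<epsilon>"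
  proof (intro exI[of _ \<epsilon>] conjI allI impI \<open>\<epsilon> > 0\<close>)
    fix n :: nat and u v :: "nat \<Rightarrow> real"
    assume "(\<forall>i<n. a \<le> u i \<and> u i \<le> v i \<and> v i \<le> b) \<and>
        disjoint_family_on (\<lambda>i. {u i<..<v i}) {..<n} \<and> (\<Sum>i<n. v i - u i) < \<epsilon>"
    then show "(\<Sum>i<n. norm (v i - u i)) < \<epsilon>" using eq[of n u v] by simp
  qed
qed

lemma lipschitz_imp_absolutely_continuous:
  assumes "L-lipschitz_on {a..b} f"
  shows "absolutely_continuous_on a b f"
proof (rule absolutely_continuous_on_dominated[OF absolutely_continuous_on_ident absolutely_continuous_on_ident])
  fix u v assume "u \<in> {a..b}" "v \<in> {a..b}"
  then have "norm (f v - f u) \<le> L * norm (v - u)"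
    using lipschitz_onD[OF assms] by (metis dist_norm)
  also have "\<dots> \<le> L * (norm (v - u) + norm (v - u))"
    using lipschitz_on_nonneg[OF assms] by (intro mult_left_mono) auto
  finally show "norm (f v - f u) \<le> L * (norm (v - u) + norm (v - u))" .
qed

lemma absolutely_continuous_imp_continuous:
  assumes "absolutely_continuous_on a b f"
  shows "continuous_on {a..b} f"
  unfolding continuous_on_iff
proof (intro ballI allI impI)
  fix s e :: real assume s: "s \<in> {a..b}" and e: "e > 0"
  obtain \<delta> where "\<delta> > 0" and \<delta>: "\<And>(n::nat) u v. \<lbrakk>\<forall>i<n. a \<le> u i \<and> u i \<le> v i \<and> v i \<le> b;
        disjoint_family_on (\<lambda>i. {u i<..<v i}) {..<n}; (\<Sum>i<n. v i - u i) < \<delta>\<rbrakk>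
         \<Longrightarrow> (\<Sum>i<n. norm (f (v i) - f (u i))) < e"
    by (rule absolutely_continuous_onE[OF assms e]) (rule that; blast)
  have "dist (f s') (f s) < e" if "s' \<in> {a..b}" "dist s' s < \<delta>" for s'
  proof (cases "s \<le> s'")
    case True
    then show ?thesis using \<delta>[of 1 "\<lambda>_. s" "\<lambda>_. s'"] that s
      by (auto simp: disjoint_family_on_def dist_norm)
  next
    case False
    then show ?thesis using \<delta>[of 1 "\<lambda>_. s'" "\<lambda>_. s"] that s
      by (auto simp: disjoint_family_on_def dist_norm norm_minus_commute)
  qed
  then show "\<exists>d>0. \<forall>x'\<in>{a..b}. dist x' s < d \<longrightarrow> dist (f x') (f s) < e"
    using \<open>\<delta> > 0\<close> by blast
qed

lemma absolutely_continuous_on_bilinear: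
  assumes bil: "bounded_bilinear mul"
    and prod1: "\<And>x y. norm (mul x y) \<le> norm x * norm y"
    and f: "absolutely_continuous_on a b f" and g: "absolutely_continuous_on a b g"
  shows "absolutely_continuous_on a b (\<lambda>t. mul (f t) (g t))"
proof -
  interpret bounded_bilinear mul by fact
  have "bounded (f ` {a..b})" "bounded (g ` {a..b})"
    using absolutely_continuous_imp_continuous f g compact_continuous_image compact_imp_bounded by blast+
  then obtain F G where F: "\<And>t. t \<in> {a..b} \<Longrightarrow> norm (f t) \<le> F" and G: "\<And>t. t \<in> {a..b} \<Longrightarrow> norm (g t) \<le> G"
    unfolding bounded_iff by (metis image_eqI)
  show ?thesis
  proof (rule absolutely_continuous_on_dominated[OF f g])
    fix u v assume uv: "u \<in> {a..b}" "v \<in> {a..b}"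
    have "mul (f v) (g v) - mul (f u) (g u) = mul (f v - f u) (g v) + mul (f u) (g v - g u)"
      by (simp add: diff_left diff_right)
    also have "norm \<dots> \<le> norm (f v - f u) * norm (g v) + norm (f u) * norm (g v - g u)"
      by (intro norm_triangle_mono prod1)
    also have "\<dots> \<le> norm (f v - f u) * (\<bar>F\<bar> + \<bar>G\<bar>) + (\<bar>F\<bar> + \<bar>G\<bar>) * norm (g v - g u)"
      using F[OF uv(1)] G[OF uv(2)] by (intro add_mono mult_left_mono mult_right_mono) auto
    finally show "norm (mul (f v) (g v) - mul (f u) (g u)) \<le> (\<bar>F\<bar> + \<bar>G\<bar>) * (norm (f v - f u) + norm (g v - g u))"
      by (simp add: algebra_simps)
  qed
qed

lemma absolutely_continuous_on_add:
  assumes "absolutely_continuous_on a b f" "absolutely_continuous_on a b g"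
  shows "absolutely_continuous_on a b (\<lambda>t. f t + g t)"
proof (rule absolutely_continuous_on_dominated[OF assms, where M = 1])
  fix u v
  show "norm (f v + g v - (f u + g u)) \<le> 1 * (norm (f v - f u) + norm (g v - g u))"
    using norm_triangle_ineq[of "f v - f u" "g v - g u"] by (simp add: algebra_simps)
qed

lemma absolutely_continuous_on_diff:
  assumes "absolutely_continuous_on a b f" "absolutely_continuous_on a b g"
  shows "absolutely_continuous_on a b (\<lambda>t. f t - g t)"
proof (rule absolutely_continuous_on_dominated[OF assms, where M = 1])
  fix u v
  show "norm (f v - g v - (f u - g u)) \<le> 1 * (norm (f v - f u) + norm (g v - g u))"
    using norm_triangle_ineq4[of "f v - f u" "g v - g u"] by (simp add: algebra_simps)
qed

text \<open>The intervals of a tagged division are indexed by the division itself, not by an initial segment of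
the natural numbers.\<close>

lemma absolutely_continuous_on_finite_family:
  assumes "absolutely_continuous_on a b f" "\<epsilon> > 0"
  obtains \<delta> where "\<delta> > 0" "\<And>(I::'i set) u v. \<lbrakk>finite I; \<And>i. i \<in> I \<Longrightarrow> a \<le> u i \<and> u i \<le> v i \<and> v i \<le> b;
      disjoint_family_on (\<lambda>i. {u i<..<v i}) I; (\<Sum>i\<in>I. v i - u i) < \<delta>\<rbrakk>
      \<Longrightarrow> (\<Sum>i\<in>I. norm (f (v i) - f (u i))) < \<epsilon>"
proof -
  obtain \<delta> where "\<delta> > 0" and \<delta>: "\<And>(n::nat) u v. \<lbrakk>\<forall>i<n. a \<le> u i \<and> u i \<le> v i \<and> v i \<le> b;
        disjoint_family_on (\<lambda>i. {u i<..<v i}) {..<n}; (\<Sum>i<n. v i - u i) < \<delta>\<rbrakk>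
         \<Longrightarrow> (\<Sum>i<n. norm (f (v i) - f (u i))) < \<epsilon>"
    by (rule absolutely_continuous_onE[OF assms]) (rule that; blast)
  show thesis
  proof (rule that[OF \<open>\<delta> > 0\<close>])
    fix I :: "'i set" and u v assume I: "finite I" "\<And>i. i \<in> I \<Longrightarrow> a \<le> u i \<and> u i \<le> v i \<and> v i \<le> b"
      "disjoint_family_on (\<lambda>i. {u i<..<v i}) I" "(\<Sum>i\<in>I. v i - u i) < \<delta>"
    obtain h where h: "bij_betw h {..<card I} I"
      using ex_bij_betw_nat_finite[OF I(1)] by (auto simp: atLeast0LessThan)
    then have hI: "h i \<in> I" if "i < card I" for i using that by (auto simp: bij_betw_def)
    have "(\<Sum>i<card I. norm (f (v (h i)) - f (u (h i)))) < \<epsilon>"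
    proof (rule \<delta>)
      show "\<forall>i<card I. a \<le> u (h i) \<and> u (h i) \<le> v (h i) \<and> v (h i) \<le> b" using I(2) hI by blast
      show "disjoint_family_on (\<lambda>i. {u (h i)<..<v (h i)}) {..<card I}"
        unfolding disjoint_family_on_def
      proof (intro ballI impI)
        fix i j assume "i \<in> {..<card I}" "j \<in> {..<card I}" "i \<noteq> j"
        then have "h i \<noteq> h j" "h i \<in> I" "h j \<in> I"
          using h hI by (auto simp: bij_betw_def inj_on_def)
        then show "{u (h i)<..<v (h i)} \<inter> {u (h j)<..<v (h j)} = {}"
          using I(3) by (simp add: disjoint_family_on_def)
      qed
      show "(\<Sum>i<card I. v (h i) - u (h i)) < \<delta>"
        using I(4) sum.reindex_bij_betw[OF h, of "\<lambda>i. v i - u i"] by simp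
    qed
    then show "(\<Sum>i\<in>I. norm (f (v i) - f (u i))) < \<epsilon>"
      using sum.reindex_bij_betw[OF h, of "\<lambda>i. norm (f (v i) - f (u i))"] by simp
  qed
qed

lemma sum_disjoint_interval_lengths:
  fixes u v :: "'i \<Rightarrow> real"
  assumes "finite I" "\<And>i. i \<in> I \<Longrightarrow> u i \<le> v i" "disjoint_family_on (\<lambda>i. {u i<..<v i}) I"
    "\<And>i. i \<in> I \<Longrightarrow> {u i<..<v i} \<subseteq> T" "T \<in> lmeasurable"
  shows "(\<Sum>i\<in>I. v i - u i) \<le> measure lebesgue T"
proof -
  have "(\<Sum>i\<in>I. v i - u i) = (\<Sum>i\<in>I. measure lebesgue {u i<..<v i})"
    using assms(2) by (intro sum.cong) auto
  also have "\<dots> = measure lebesgue (\<Union>i\<in>I. {u i<..<v i})"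
    by (rule measure_finite_Union[symmetric]) (use assms in \<open>auto simp: emeasure_lborel_Ioo\<close>)
  also have "\<dots> \<le> measure lebesgue T"
    using assms(1,4,5) by (intro measure_mono_fmeasurable) auto
  finally show ?thesis .
qed

text \<open>Cousin's argument for \<open>F t - D t\<close>. The null set \<open>N\<close> is covered by an open set so small that, by absolute
continuity, the division intervals tagged in \<open>N\<close> contribute at most \<open>\<epsilon> / 2\<close>. Any other division
interval straddles a tag at which the slope of \<open>F\<close> is at least \<open>D\<close>, and so contributes at least \<open>-e\<close> times its
length.\<close>

lemma absolutely_continuous_mean_value:
  fixes F :: "real \<Rightarrow> real"
  assumes F: "absolutely_continuous_on c d F" and cd: "c \<le> d" and N: "negligible N"
    and D: "\<And>t. \<lbrakk>c < t; t < d; t \<notin> N\<rbrakk> \<Longrightarrow> \<exists>E B. approx_deriv F t E B \<and> D \<le> E - B"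
  shows "D * (d - c) \<le> F d - F c"
proof (rule field_le_epsilon)
  fix \<epsilon> :: real assume \<epsilon>: "\<epsilon> > 0"
  define e where "e = \<epsilon> / (2 * (d - c + 1))"
  have e: "e > 0" using \<epsilon> cd by (simp add: e_def)
  have e_small: "e * (d - c) \<le> \<epsilon> / 2"
    using \<epsilon> cd by (simp add: e_def field_simps mult_left_mono)
  \<comment> \<open>the slope is controlled only inside the interval, so the end points join the null set\<close>
  define N' where "N' = N \<union> {c, d}"
  have N': "negligible N'" unfolding N'_def using N by (simp add: negligible_Un)
  define F' where "F' t = F t - D * t" for t
  have F': "absolutely_continuous_on c d F'"
  proof -
    have "\<bar>D\<bar>-lipschitz_on {c..d} (\<lambda>t. D * t)"
      by (rule lipschitz_onI) (auto simp: dist_real_def right_diff_distrib[symmetric] abs_mult)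
    from absolutely_continuous_on_diff[OF F lipschitz_imp_absolutely_continuous[OF this]]
    show ?thesis unfolding F'_def .
  qed
  obtain \<delta> where "\<delta> > 0" and \<delta>: "\<And>(I::(real \<times> real set) set) u v. \<lbrakk>finite I; \<And>i. i \<in> I \<Longrightarrow> c \<le> u i \<and> u i \<le> v i \<and> v i \<le> d;
      disjoint_family_on (\<lambda>i. {u i<..<v i}) I; (\<Sum>i\<in>I. v i - u i) < \<delta>\<rbrakk>
      \<Longrightarrow> (\<Sum>i\<in>I. norm (F' (v i) - F' (u i))) < \<epsilon> / 2"
    by (rule absolutely_continuous_on_finite_family[OF F' half_gt_zero[OF \<epsilon>]]) (rule that; blast)
  obtain T where T: "open T" "N' \<subseteq> T" "T \<in> lmeasurable" "measure lebesgue T < \<delta>"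
  proof -
    have "N' \<in> sets lebesgue" using N' negligible_imp_sets by blast
    then obtain T where T: "open T" "N' \<subseteq> T" "T - N' \<in> lmeasurable" "emeasure lebesgue (T - N') < ennreal \<delta>"
      using sets_lebesgue_outer_open \<open>\<delta> > 0\<close> by blast
    have Nl: "N' \<in> lmeasurable" using N' negligible_imp_measurable by blast
    have "T = (T - N') \<union> N'" using T(2) by auto
    then have Tl: "T \<in> lmeasurable" using T(3) Nl fmeasurable.Un by metis
    have "measure lebesgue T = measure lebesgue (T - N')"
      using N' T(2) by (metis Tl measure_Diff_null_set negligible_iff_null_sets fmeasurableD)
    also have "\<dots> < \<delta>" using T(3,4) by (simp add: emeasure_eq_measure2 \<open>\<delta> > 0\<close> ennreal_less_iff)
    finally show thesis using that T(1,2) Tl by blast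
  qed
  have "\<exists>\<eta>>0. (t \<in> N' \<longrightarrow> ball t \<eta> \<subseteq> T) \<and> (t \<notin> N' \<longrightarrow> c < t \<longrightarrow> t < d \<longrightarrow>
      (\<forall>u v. t - \<eta> < u \<and> u \<le> t \<and> t \<le> v \<and> v < t + \<eta> \<longrightarrow> F' v - F' u \<ge> - e * (v - u)))" for t
  proof (cases "t \<in> N' \<or> \<not> (c < t \<and> t < d)")
    case True
    have "\<exists>\<eta>>0. t \<in> N' \<longrightarrow> ball t \<eta> \<subseteq> T"
    proof (cases "t \<in> N'")
      case True
      then show ?thesis using T(1,2) unfolding open_contains_ball by blast
    next
      case False
      then show ?thesis by (intro exI[of _ 1]) simp
    qed
    with True show ?thesis by blast
  next
    case False
    then obtain E B where EB: "approx_deriv F t E B" "D \<le> E - B" using D[of t] by (auto simp: N'_def)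
    obtain \<eta> where \<eta>: "\<eta> > 0" "\<And>u v. \<lbrakk>t - \<eta> < u; u \<le> t; t \<le> v; v < t + \<eta>\<rbrakk> \<Longrightarrow>
      norm (F v - F u - (v - u) *\<^sub>R E) \<le> (B + e) * (v - u)"
      using eventually_straddle[OF approx_derivD[OF EB(1) e]] by auto
    have "F' v - F' u \<ge> - e * (v - u)" if "t - \<eta> < u" "u \<le> t" "t \<le> v" "v < t + \<eta>" for u v
    proof -
      have "F v - F u \<ge> (E - B - e) * (v - u)"
        using \<eta>(2)[OF that] by (auto simp: abs_le_iff algebra_simps)
      moreover have "(E - B - e) * (v - u) \<ge> (D - e) * (v - u)"
        using EB(2) that by (intro mult_right_mono) auto
      ultimately show ?thesis by (simp add: F'_def algebra_simps)
    qed
    then show ?thesis using \<eta>(1) False by blast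
  qed
  then obtain \<eta> where \<eta>: "\<And>t. \<eta> t > 0" "\<And>t. t \<in> N' \<Longrightarrow> ball t (\<eta> t) \<subseteq> T"
    "\<And>t u v. \<lbrakk>t \<notin> N'; c < t; t < d; t - \<eta> t < u; u \<le> t; t \<le> v; v < t + \<eta> t\<rbrakk> \<Longrightarrow> F' v - F' u \<ge> - e * (v - u)"
    by metis
  have "gauge (\<lambda>t. ball t (\<eta> t))" using \<eta>(1) by (auto simp: gauge_def)
  then obtain p where p: "p tagged_division_of {c..d}" "(\<lambda>t. ball t (\<eta> t)) fine p"
    using fine_division_exists_real by blast
  note pD = tagged_division_ofD[OF p(1)]
  define u where "u = (\<lambda>i::real \<times> real set. Inf (snd i))"
  define v where "v = (\<lambda>i::real \<times> real set. Sup (snd i))"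
  have iv: "snd i = {u i..v i} \<and> u i \<le> fst i \<and> fst i \<le> v i \<and> c \<le> u i \<and> v i \<le> d \<and> {u i..v i} \<subseteq> ball (fst i) (\<eta> (fst i))"
    if ip: "i \<in> p" for i
  proof -
    obtain t K where i: "i = (t, K)" by fastforce
    obtain l h where K: "K = {l..h}" using pD(4)[of t K] ip unfolding i box_real by blast
    have "t \<in> K" "K \<subseteq> {c..d}" using pD(2,3)[of t K] ip i by auto
    moreover have "K \<subseteq> ball t (\<eta> t)" using p(2) ip i by (auto simp: fine_def)
    moreover have "u i = l" "v i = h" using \<open>t \<in> K\<close> K i by (auto simp: u_def v_def)
    ultimately show ?thesis using i K by auto
  qed
  have disj: "disjoint_family_on (\<lambda>i. {u i<..<v i}) p"
    unfolding disjoint_family_on_def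
  proof (intro ballI impI)
    fix i j assume ij: "i \<in> p" "j \<in> p" "i \<noteq> j"
    have "interior (snd i) \<inter> interior (snd j) = {}"
      using pD(5)[of "fst i" "snd i" "fst j" "snd j"] ij by simp
    then show "{u i<..<v i} \<inter> {u j<..<v j} = {}"
      using iv[OF ij(1)] iv[OF ij(2)] by simp
  qed
  define A where "A = {i \<in> p. fst i \<in> N'}"
  have fin: "finite p" "finite A" "A \<subseteq> p" using pD(1) by (auto simp: A_def)
  have tele: "(\<Sum>i\<in>p. g (v i) - g (u i)) = g d - g c" for g :: "real \<Rightarrow> real"
    using additive_tagged_division_1[OF cd p(1), of g] by (simp add: u_def v_def case_prod_beta)
  have disjA: "disjoint_family_on (\<lambda>i. {u i<..<v i}) A"
    using disj fin(3) by (meson disjoint_family_on_mono)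
  have "(\<Sum>i\<in>A. v i - u i) \<le> measure lebesgue T"
  proof (rule sum_disjoint_interval_lengths[OF fin(2) _ disjA _ T(3)])
    fix i assume "i \<in> A"
    then have i: "i \<in> p" "fst i \<in> N'" by (auto simp: A_def)
    show "u i \<le> v i" using iv[OF i(1)] by auto
    show "{u i<..<v i} \<subseteq> T" using iv[OF i(1)] \<eta>(2)[OF i(2)] by force
  qed
  then have "(\<Sum>i\<in>A. norm (F' (v i) - F' (u i))) < \<epsilon> / 2"
    using iv fin(3) T(4) by (intro \<delta>[OF fin(2) _ disjA]) (force simp: subset_iff)+
  moreover have "(\<Sum>i\<in>A. F' (v i) - F' (u i)) \<ge> - (\<Sum>i\<in>A. norm (F' (v i) - F' (u i)))"
    unfolding sum_negf[symmetric] by (intro sum_mono) auto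
  ultimately have sA: "(\<Sum>i\<in>A. F' (v i) - F' (u i)) \<ge> - (\<epsilon> / 2)" by linarith
  have "(\<Sum>i\<in>p - A. F' (v i) - F' (u i)) \<ge> (\<Sum>i\<in>p - A. - e * (v i - u i))"
  proof (intro sum_mono)
    fix i assume "i \<in> p - A"
    then have i: "i \<in> p" "fst i \<notin> N'" by (auto simp: A_def)
    have "fst i \<noteq> c" "fst i \<noteq> d" using i(2) by (auto simp: N'_def)
    then have "c < fst i" "fst i < d" using iv[OF i(1)] by auto
    moreover have "u i \<in> ball (fst i) (\<eta> (fst i))" "v i \<in> ball (fst i) (\<eta> (fst i))"
      using iv[OF i(1)] by (meson atLeastAtMost_iff order_refl order_trans subsetD)+
    ultimately show "- e * (v i - u i) \<le> F' (v i) - F' (u i)"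
      using iv[OF i(1)] i(2) by (intro \<eta>(3)[of "fst i"]) (auto simp: dist_real_def)
  qed
  moreover have "(\<Sum>i\<in>p - A. - e * (v i - u i)) \<ge> (\<Sum>i\<in>p. - e * (v i - u i))"
  proof -
    have "(\<Sum>i\<in>p - A. e * (v i - u i)) \<le> (\<Sum>i\<in>p. e * (v i - u i))"
      using fin(1) by (rule sum_mono2) (use iv e in \<open>force intro: mult_nonneg_nonneg\<close>)+
    then show ?thesis by (simp add: sum_negf)
  qed
  moreover have "(\<Sum>i\<in>p. - e * (v i - u i)) = - e * (d - c)"
    using tele[of "\<lambda>t. t"] by (simp only: sum_distrib_left[symmetric])
  moreover have "(\<Sum>i\<in>p. F' (v i) - F' (u i)) = (\<Sum>i\<in>A. F' (v i) - F' (u i)) + (\<Sum>i\<in>p - A. F' (v i) - F' (u i))"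
    using sum.subset_diff[OF fin(3,1), of "\<lambda>i. F' (v i) - F' (u i)"] by (simp only: add.commute)
  ultimately have "F' d - F' c \<ge> - \<epsilon>"
    using tele[of F'] sA e_small by linarith
  then show "D * (d - c) \<le> F d - F c + \<epsilon>" by (simp add: F'_def algebra_simps)
qed

section \<open>Smooth step functions\<close>

text \<open>The derivatives of the standard flat function \<open>exp (- 1 / x)\<close> are linear combinations of these.\<close>

definition flat :: "nat \<Rightarrow> real \<Rightarrow> real" where
  "flat n x = (if x > 0 then inverse x ^ n * exp (- inverse x) else 0)"

lemma flat_tendsto_0: "(flat n \<longlongrightarrow> 0) (at 0)"
proof -
  have "((\<lambda>x. inverse x ^ n / exp (inverse x)) \<longlongrightarrow> (0::real)) (at_right 0)"
    by (rule filterlim_compose[OF tendsto_power_div_exp_0 filterlim_inverse_at_top_right])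
  then have "(flat n \<longlongrightarrow> 0) (at_right 0)"
    by (rule Lim_transform_eventually) (auto simp: flat_def eventually_at_filter exp_minus divide_inverse)
  moreover have "(flat n \<longlongrightarrow> 0) (at_left 0)"
    by (rule tendsto_eventually) (auto simp: flat_def eventually_at_filter)
  ultimately show ?thesis by (simp add: filterlim_split_at)
qed

lemma DERIV_flat: "(flat n has_real_derivative (flat (Suc (Suc n)) x - real n * flat (Suc n) x)) (at x)"
proof (cases x "0 :: real" rule: linorder_cases)
  case less
  have "((\<lambda>_. 0) has_real_derivative 0) (at x)" by simp
  then have "(flat n has_real_derivative 0) (at x)"
    by (rule has_field_derivative_transform_within_open[where S = "{..<0}"]) (use less in \<open>auto simp: flat_def\<close>)
  then show ?thesis using less by (simp add: flat_def)
next
  case equal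
  have "((\<lambda>h. flat (Suc n) h) \<longlongrightarrow> 0) (at 0)" by (rule flat_tendsto_0)
  then have "((\<lambda>h. (flat n h - flat n 0) / (h - 0)) \<longlongrightarrow> 0) (at 0)"
    by (rule Lim_transform_eventually) (auto simp: flat_def eventually_at_filter field_simps)
  then have "(flat n has_real_derivative 0) (at 0)"
    by (simp add: has_field_derivative_iff)
  then show ?thesis using equal by (simp add: flat_def)
next
  case greater
  have inv: "(inverse has_real_derivative - (inverse x * inverse x)) (at x)"
    using DERIV_inverse[of x UNIV] greater by (simp add: power2_eq_square)
  have ex: "((\<lambda>x. exp (- inverse x)) has_real_derivative exp (- inverse x) * (inverse x * inverse x)) (at x)"
    using DERIV_fun_exp[OF DERIV_minus[OF inv]] by simp
  have "((\<lambda>x. inverse x ^ n * exp (- inverse x)) has_real_derivative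
      (flat (Suc (Suc n)) x - real n * flat (Suc n) x)) (at x)"
  proof (cases n)
    case 0
    show ?thesis using ex greater by (simp add: 0 flat_def mult_ac)
  next
    case (Suc k)
    show ?thesis unfolding Suc
      by (rule DERIV_mult[OF DERIV_power_Suc[OF inv] ex, THEN DERIV_cong])
         (use greater in \<open>simp add: flat_def algebra_simps\<close>)
  qed
  then show ?thesis
    by (rule has_field_derivative_transform_within_open[where S = "{0<..}"]) (use greater in \<open>auto simp: flat_def\<close>)
qed

text \<open>A class of functions that is closed under differentiation by construction: each generation rule is
matched by a differentiation rule with result in the class. Hence all its members have derivatives of
every order.\<close>

inductive_set smooth_functions :: "(real \<Rightarrow> real) set" where
  flat: "flat n \<in> smooth_functions"
| const: "(\<lambda>_. c) \<in> smooth_functions"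
| add: "\<lbrakk>f \<in> smooth_functions; g \<in> smooth_functions\<rbrakk> \<Longrightarrow> (\<lambda>x. f x + g x) \<in> smooth_functions"
| mult: "\<lbrakk>f \<in> smooth_functions; g \<in> smooth_functions\<rbrakk> \<Longrightarrow> (\<lambda>x. f x * g x) \<in> smooth_functions"
| inverse: "\<lbrakk>f \<in> smooth_functions; \<And>x. f x \<noteq> 0\<rbrakk> \<Longrightarrow> (\<lambda>x. inverse (f x)) \<in> smooth_functions"
| affine: "f \<in> smooth_functions \<Longrightarrow> (\<lambda>x. f (\<alpha> * x + \<beta>)) \<in> smooth_functions"

lemma smooth_functions_deriv:
  assumes "f \<in> smooth_functions"
  shows "\<exists>g\<in>smooth_functions. \<forall>x. (f has_real_derivative g x) (at x)"
  using assms
proof induction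
  case (flat n)
  let ?g = "\<lambda>x. flat (Suc (Suc n)) x + (- real n) * flat (Suc n) x"
  have "?g \<in> smooth_functions"
    by (intro smooth_functions.add smooth_functions.mult smooth_functions.const smooth_functions.flat)
  moreover have "(flat n has_real_derivative ?g x) (at x)" for x
    using DERIV_flat[of n x] by simp
  ultimately show ?case by (intro bexI[of _ ?g]) auto
next
  case (const c)
  show ?case by (intro bexI[of _ "\<lambda>_. 0"] smooth_functions.const) auto
next
  case (add f g)
  then obtain f' g' where "f' \<in> smooth_functions" "g' \<in> smooth_functions"
    "\<And>x. (f has_real_derivative f' x) (at x)" "\<And>x. (g has_real_derivative g' x) (at x)" by blast
  then show ?case
    by (intro bexI[of _ "\<lambda>x. f' x + g' x"] smooth_functions.add) (auto intro!: derivative_eq_intros)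
next
  case (mult f g)
  then obtain f' g' where fg: "f' \<in> smooth_functions" "g' \<in> smooth_functions"
    "\<And>x. (f has_real_derivative f' x) (at x)" "\<And>x. (g has_real_derivative g' x) (at x)" by blast
  have "((\<lambda>x. f x * g x) has_real_derivative (f' x * g x + g' x * f x)) (at x)" for x
    by (rule DERIV_mult[OF fg(3,4)])
  moreover have "(\<lambda>x. f' x * g x + g' x * f x) \<in> smooth_functions"
    using fg mult by (intro smooth_functions.add smooth_functions.mult)
  ultimately show ?case by (intro bexI[of _ "\<lambda>x. f' x * g x + g' x * f x"]) auto
next
  case (inverse f)
  then obtain f' where f: "f' \<in> smooth_functions" "\<And>x. (f has_real_derivative f' x) (at x)" by blast
  have "((\<lambda>x. inverse (f x)) has_real_derivative ((-1) * (inverse (f x) * f' x * inverse (f x)))) (at x)" for x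
    by (rule DERIV_inverse'[OF f(2) inverse(2), THEN DERIV_cong]) simp
  moreover have "(\<lambda>x. (-1) * (inverse (f x) * f' x * inverse (f x))) \<in> smooth_functions"
    using f inverse by (intro smooth_functions.mult smooth_functions.const smooth_functions.inverse) auto
  ultimately show ?case by (intro bexI[of _ "\<lambda>x. (-1) * (inverse (f x) * f' x * inverse (f x))"]) auto
next
  case (affine f \<alpha> \<beta>)
  then obtain f' where f: "f' \<in> smooth_functions" "\<And>x. (f has_real_derivative f' x) (at x)" by blast
  have "((\<lambda>x. f (\<alpha> * x + \<beta>)) has_real_derivative (f' (\<alpha> * x + \<beta>) * \<alpha>)) (at x)" for x
    by (rule DERIV_chain2[OF f(2)]) (auto intro!: derivative_eq_intros)
  moreover have "(\<lambda>x. f' (\<alpha> * x + \<beta>) * \<alpha>) \<in> smooth_functions"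
    using f by (intro smooth_functions.mult smooth_functions.const smooth_functions.affine)
  ultimately show ?case by (intro bexI[of _ "\<lambda>x. f' (\<alpha> * x + \<beta>) * \<alpha>"]) auto
qed

lemma smooth_functions_deriv':
  assumes "f \<in> smooth_functions"
  shows "deriv f \<in> smooth_functions" "(f has_real_derivative deriv f x) (at x)"
proof -
  obtain g where g: "g \<in> smooth_functions" "\<And>x. (f has_real_derivative g x) (at x)"
    using smooth_functions_deriv[OF assms] by blast
  then have "deriv f = g" using DERIV_imp_deriv by blast
  with g show "deriv f \<in> smooth_functions" "(f has_real_derivative deriv f x) (at x)" by auto
qed

lemma smooth_functions_funpow_deriv: "f \<in> smooth_functions \<Longrightarrow> (deriv ^^ n) f \<in> smooth_functions"
  by (induction n) (auto intro: smooth_functions_deriv')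

lemma test_function_onI:
  assumes "f \<in> smooth_functions" "compact K" "K \<subseteq> I" "\<And>t. t \<notin> K \<Longrightarrow> f t = 0"
  shows "test_function_on I f"
  unfolding test_function_on_def
  using assms smooth_functions_funpow_deriv smooth_functions_deriv'(2)
  by (meson field_differentiable_def)

text \<open>A smooth transition from \<open>0\<close> on the negative axis to \<open>1\<close> beyond \<open>1\<close>. The denominator never vanishes, since
at least one of \<open>x\<close> and \<open>1 - x\<close> is positive.\<close>

definition smooth_step :: "real \<Rightarrow> real" where
  "smooth_step x = flat 0 x * inverse (flat 0 x + flat 0 (1 - x))"

lemma flat0_denom_pos: "flat 0 x + flat 0 (1 - x) > 0"
  by (auto simp: flat_def add_pos_pos)

lemma smooth_step_smooth: "smooth_step \<in> smooth_functions"
proof -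
  have 1: "flat 0 \<in> smooth_functions" by (rule smooth_functions.flat)
  have 2: "(\<lambda>x. flat 0 (1 - x)) \<in> smooth_functions" using smooth_functions.affine[OF 1, of "-1" 1] by simp
  have "(\<lambda>x. flat 0 x * inverse (flat 0 x + flat 0 (1 - x))) \<in> smooth_functions"
    by (intro smooth_functions.mult smooth_functions.inverse smooth_functions.add 1 2)
       (use flat0_denom_pos less_irrefl in metis)
  then show ?thesis by (simp add: smooth_step_def[abs_def])
qed

lemma smooth_step_eq_0: "x \<le> 0 \<Longrightarrow> smooth_step x = 0"
  by (simp add: smooth_step_def flat_def)

lemma smooth_step_eq_1: "x \<ge> 1 \<Longrightarrow> smooth_step x = 1"
  by (simp add: smooth_step_def flat_def)

lemma smooth_step_bounds: "0 \<le> smooth_step x" "smooth_step x \<le> 1"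
proof -
  have "flat 0 y \<ge> 0" for y by (simp add: flat_def)
  then show "0 \<le> smooth_step x" "smooth_step x \<le> 1"
    using flat0_denom_pos[of x] by (auto simp: smooth_step_def field_simps)
qed

lemmas smooth_step_deriv = smooth_functions_deriv'(2)[OF smooth_step_smooth]

lemma deriv_smooth_step_outside:
  assumes "x < 0 \<or> x > 1"
  shows "deriv smooth_step x = 0"
proof (rule DERIV_imp_deriv)
  from assms show "(smooth_step has_real_derivative 0) (at x)"
  proof
    assume "x < 0"
    show ?thesis
      by (rule has_field_derivative_transform_within_open[where S = "{..<0}" and f = "\<lambda>_. 0"])
         (use \<open>x < 0\<close> smooth_step_eq_0 in auto)
  next
    assume "x > 1"
    show ?thesis
      by (rule has_field_derivative_transform_within_open[where S = "{1<..}" and f = "\<lambda>_. 1"])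
         (use \<open>x > 1\<close> smooth_step_eq_1 in auto)
  qed
qed

lemma continuous_deriv_smooth_step: "continuous_on A (deriv smooth_step)"
  using smooth_functions_deriv'[OF smooth_functions_deriv'(1)[OF smooth_step_smooth]]
  by (meson DERIV_isCont continuous_at_imp_continuous_on)

lemma deriv_smooth_step_bounded: obtains B where "B > 0" "\<And>x. \<bar>deriv smooth_step x\<bar> \<le> B"
proof -
  have "bounded (deriv smooth_step ` {0..1})"
    by (intro compact_imp_bounded compact_continuous_image continuous_deriv_smooth_step compact_Icc)
  then obtain B where B: "\<And>x. x \<in> {0..1} \<Longrightarrow> \<bar>deriv smooth_step x\<bar> \<le> B"
    unfolding bounded_iff by (metis image_eqI real_norm_def)
  show thesis
  proof (rule that[of "\<bar>B\<bar> + 1"])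
    fix x
    show "\<bar>deriv smooth_step x\<bar> \<le> \<bar>B\<bar> + 1"
      using B[of x] deriv_smooth_step_outside[of x] by (cases "x \<in> {0..1}") auto
  qed simp
qed

text \<open>The derivative of a transition over \<open>[s, s + h]\<close>; as \<open>h\<close> tends to zero this is an approximate
identity at \<open>s\<close>.\<close>

definition bump :: "real \<Rightarrow> real \<Rightarrow> real \<Rightarrow> real" where
  "bump h s t = deriv smooth_step ((t - s) / h) / h"

lemma DERIV_scaled_step:
  assumes "h > 0"
  shows "((\<lambda>t. smooth_step ((t - s) / h)) has_real_derivative bump h s t) (at t)"
  unfolding bump_def
  by (rule DERIV_chain2[OF smooth_step_deriv, THEN DERIV_cong]) (use assms in \<open>auto intro!: derivative_eq_intros\<close>)

lemma bump_outside: "h > 0 \<Longrightarrow> t \<notin> {s..s + h} \<Longrightarrow> bump h s t = 0"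
  by (auto simp: bump_def field_simps intro!: deriv_smooth_step_outside)

lemma continuous_bump: "h > 0 \<Longrightarrow> continuous_on A (bump h s)"
  unfolding bump_def
  by (intro continuous_intros continuous_on_compose2[OF continuous_deriv_smooth_step[of UNIV]]) auto

lemma integral_bump:
  assumes "h > 0"
  shows "(bump h s has_integral 1) {s..s + h}"
proof -
  have "(bump h s has_integral (smooth_step ((s + h - s) / h) - smooth_step ((s - s) / h))) {s..s + h}"
    using DERIV_scaled_step[OF assms] assms
    by (intro fundamental_theorem_of_calculus)
       (auto simp: has_real_derivative_iff_has_vector_derivative[symmetric] intro: DERIV_subset)
  then show ?thesis using assms by (simp add: smooth_step_eq_0 smooth_step_eq_1)
qed

section \<open>Bounded weak derivatives\<close>

lemma integrable_bounded_mult: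
  fixes f :: "real \<Rightarrow> complex" and g :: "real \<Rightarrow> real"
  assumes f: "Linf_on {a<..<b} f" and g: "continuous_on UNIV g" "\<And>t. \<bar>g t\<bar> \<le> B"
  shows "integrable (lebesgue_on {a<..<b}) (\<lambda>t. f t * of_real (g t))"
proof -
  obtain C where meas: "f \<in> borel_measurable (lebesgue_on {a<..<b})"
    and C: "AE t in lebesgue_on {a<..<b}. cmod (f t) \<le> C"
    using f by (auto simp: Linf_on_def)
  interpret finite_measure "lebesgue_on {a<..<b}"
    by (rule finite_measure_lebesgue_on) auto
  show ?thesis
  proof (rule integrable_const_bound)
    show "AE t in lebesgue_on {a<..<b}. norm (f t * of_real (g t)) \<le> C * B"
      using C by eventually_elim (auto simp: norm_mult intro!: mult_mono g intro: order_trans[OF norm_ge_zero])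
    have "(\<lambda>t. complex_of_real (g t)) \<in> borel_measurable (lebesgue_on {a<..<b})"
      by (rule continuous_imp_measurable_on_sets_lebesgue) (auto intro!: continuous_intros continuous_on_subset[OF g(1)])
    with meas show "(\<lambda>t. f t * of_real (g t)) \<in> borel_measurable (lebesgue_on {a<..<b})" by simp
  qed
qed

text \<open>The bump has integral \<open>1\<close>, so the difference is the integral of \<open>(f t - f s)\<close> times the bump; it lives on an
interval of length \<open>h\<close>, where the bump is at most \<open>B / h\<close>.\<close>

lemma bump_average_close:
  fixes f :: "real \<Rightarrow> complex"
  assumes h: "h > 0" and J: "{s..s + h} \<subseteq> {a<..<b}" and f: "continuous_on {a<..<b} f"
    and B: "\<And>x. \<bar>deriv smooth_step x\<bar> \<le> B" and e: "\<And>t. t \<in> {s..s + h} \<Longrightarrow> cmod (f t - f s) \<le> e"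
  shows "cmod ((LINT t|lebesgue_on {a<..<b}. f t * of_real (bump h s t)) - f s) \<le> e * B"
proof -
  let ?J = "{s..s + h}"
  let ?F = "\<lambda>t. f t * of_real (bump h s t)"
  have cJ: "continuous_on ?J ?F"
    by (intro continuous_intros continuous_on_subset[OF f J] continuous_bump h)
  have "(LINT t|lebesgue_on {a<..<b}. ?F t) = (LINT t|lebesgue. indicator {a<..<b} t *\<^sub>R ?F t)"
    by (rule integral_restrict_space) auto
  also have "\<dots> = (LINT t|lebesgue. indicator ?J t *\<^sub>R ?F t)"
  proof (rule Bochner_Integration.integral_cong[OF refl])
    fix t
    show "indicator {a<..<b} t *\<^sub>R ?F t = indicator ?J t *\<^sub>R ?F t"
      using J bump_outside[OF h, of t s] by (cases "t \<in> ?J") (auto simp: indicator_def subset_iff)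
  qed
  also have "\<dots> = (LINT t|lebesgue_on ?J. ?F t)"
    by (rule integral_restrict_space[symmetric]) auto
  also have "\<dots> = integral ?J ?F"
    by (intro lebesgue_integral_eq_integral continuous_imp_integrable_real cJ) auto
  finally have 1: "(LINT t|lebesgue_on {a<..<b}. ?F t) = integral ?J ?F" .
  have "((\<lambda>t. complex_of_real (bump h s t)) has_integral complex_of_real 1) ?J"
    using integral_bump[OF h] by (rule has_integral_of_real)
  from has_integral_mult_right[OF this, of "f s"]
  have "((\<lambda>t. f s * complex_of_real (bump h s t)) has_integral f s * 1) ?J" by simp
  moreover have "(?F has_integral integral ?J ?F) ?J"
    using integrable_continuous_real[OF cJ] integrable_integral by blast
  ultimately have "((\<lambda>t. ?F t - f s * complex_of_real (bump h s t)) has_integral (integral ?J ?F - f s * 1)) ?J"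
    by (rule has_integral_diff[rotated])
  then have 2: "integral ?J ?F - f s = integral ?J (\<lambda>t. (f t - f s) * complex_of_real (bump h s t))"
    by (simp add: integral_unique algebra_simps)
  have e0: "e \<ge> 0" using e[of s] h by simp
  have "cmod (integral ?J (\<lambda>t. (f t - f s) * complex_of_real (bump h s t))) \<le> (e * (B / h)) * (s + h - s)"
  proof (rule integral_bound)
    show "continuous_on ?J (\<lambda>t. (f t - f s) * complex_of_real (bump h s t))"
      by (intro continuous_intros continuous_on_subset[OF f J] continuous_bump h)
    show "cmod ((f t - f s) * complex_of_real (bump h s t)) \<le> e * (B / h)" if "t \<in> ?J" for t
    proof -
      have "\<bar>bump h s t\<bar> \<le> B / h"
        using B[of "(t - s) / h"] h by (simp add: bump_def divide_right_mono)
      then show ?thesis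
        unfolding norm_mult norm_of_real by (intro mult_mono e[OF that] e0) auto
    qed
  qed (use h in auto)
  also have "\<dots> = e * B" using h by simp
  finally show ?thesis unfolding 1 2 .
qed

text \<open>The weak derivative is tested with a smoothed indicator function of \<open>[s, t]\<close>, rising at \<open>s\<close> and falling at \<open>t\<close> over a length \<open>h\<close>. Its derivative is a difference of two approximate
identities, so one side of the defining identity is close to \<open>f s - f t\<close>, while the other is at most
\<open>C (t + h - s)\<close>.\<close>

lemma weak_deriv_imp_lipschitz:
  fixes f g :: "real \<Rightarrow> complex"
  assumes f: "Linf_on {a<..<b} f" "continuous_on {a<..<b} f"
    and g: "Linf_on {a<..<b} g" and weak: "weak_deriv_on 1 {a<..<b} f g"
  obtains L where "L-lipschitz_on {a<..<b} f"
proof -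
  let ?I = "{a<..<b}"
  obtain C0 where meas: "g \<in> borel_measurable (lebesgue_on ?I)"
    and C0: "AE t in lebesgue_on ?I. cmod (g t) \<le> C0"
    using g by (auto simp: Linf_on_def)
  define C where "C = \<bar>C0\<bar>"
  have C: "AE t in lebesgue_on ?I. cmod (g t) \<le> C" using C0 by eventually_elim (simp add: C_def)
  have C_nonneg: "C \<ge> 0" by (simp add: C_def)
  obtain B where B: "B > 0" "\<And>x. \<bar>deriv smooth_step x\<bar> \<le> B" by (rule deriv_smooth_step_bounded) (rule that; blast)
  have main: "cmod (f s - f t) \<le> C * (t - s)" if st: "a < s" "s < t" "t < b" for s t
  proof (rule field_le_epsilon)
    fix \<epsilon> :: real assume \<epsilon>: "\<epsilon> > 0"
    define e where "e = \<epsilon> / (3 * B)"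
    have e: "e > 0" "e * B = \<epsilon> / 3" using \<epsilon> B(1) by (auto simp: e_def)
    have close: "\<exists>d>0. \<forall>\<tau>. \<bar>\<tau> - r\<bar> < d \<longrightarrow> cmod (f \<tau> - f r) \<le> e" if "r \<in> ?I" for r
    proof -
      have "isCont f r" using f(2) that by (simp add: continuous_on_eq_continuous_at)
      then show ?thesis using e(1) unfolding continuous_at_eps_delta
        by (metis dist_norm dist_real_def less_imp_le)
    qed
    obtain d1 d2 where d1: "d1 > 0" "\<And>\<tau>. \<bar>\<tau> - s\<bar> < d1 \<Longrightarrow> cmod (f \<tau> - f s) \<le> e"
      and d2: "d2 > 0" "\<And>\<tau>. \<bar>\<tau> - t\<bar> < d2 \<Longrightarrow> cmod (f \<tau> - f t) \<le> e"
      using close[of s] close[of t] st by auto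
    define h where "h = Min {d1 / 2, d2 / 2, (b - t) / 2, \<epsilon> / (3 * (C + 1))}"
    have h: "h > 0" using d1 d2 st \<epsilon> C_nonneg by (simp add: h_def)
    have "h \<le> d1 / 2" "h \<le> d2 / 2" "h \<le> (b - t) / 2" and hle4: "h \<le> \<epsilon> / (3 * (C + 1))"
      unfolding h_def by (rule Min_le; simp)+
    then have hle: "h < d1" "h < d2" "t + h < b" using d1(1) d2(1) st by auto
    have Ch: "C * h \<le> \<epsilon> / 3"
    proof -
      have "C * h \<le> (C + 1) * (\<epsilon> / (3 * (C + 1)))"
        using C_nonneg h hle4 by (intro mult_mono) auto
      also have "\<dots> = \<epsilon> / 3" using C_nonneg by (simp add: field_simps)
      finally show ?thesis .
    qed
    define \<psi> where "\<psi> \<tau> = smooth_step ((\<tau> - s) / h) - smooth_step ((\<tau> - t) / h)" for \<tau>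
    have smooth: "\<psi> \<in> smooth_functions"
    proof -
      have "(\<lambda>\<tau>. smooth_step (inverse h * \<tau> + - s / h) + (-1) * smooth_step (inverse h * \<tau> + - t / h)) \<in> smooth_functions"
        by (intro smooth_functions.add smooth_functions.mult smooth_functions.const smooth_functions.affine smooth_step_smooth)
      also have "(\<lambda>\<tau>. smooth_step (inverse h * \<tau> + - s / h) + (-1) * smooth_step (inverse h * \<tau> + - t / h)) = \<psi>"
        unfolding \<psi>_def by (intro ext) (simp add: divide_inverse algebra_simps)
      finally show ?thesis .
    qed
    have supp: "\<psi> \<tau> = 0" if "\<tau> \<notin> {s..t + h}" for \<tau>
      using that st h by (auto simp: \<psi>_def smooth_step_eq_0 smooth_step_eq_1 not_le divide_nonpos_pos field_simps)
    have abs1: "\<bar>\<psi> \<tau>\<bar> \<le> 1" for \<tau>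
      using smooth_step_bounds[of "(\<tau> - s) / h"] smooth_step_bounds[of "(\<tau> - t) / h"] by (auto simp: \<psi>_def abs_le_iff)
    have test: "test_function_on ?I \<psi>"
      by (rule test_function_onI[OF smooth, of "{s..t + h}"]) (use st hle supp in auto)
    have deriv: "deriv \<psi> = (\<lambda>\<tau>. bump h s \<tau> - bump h t \<tau>)"
      unfolding \<psi>_def by (intro ext DERIV_imp_deriv DERIV_diff DERIV_scaled_step h)
    have bump_bound: "\<bar>bump h r \<tau>\<bar> \<le> B / h" for r \<tau>
      using B(2)[of "(\<tau> - r) / h"] h by (simp add: bump_def divide_right_mono)
    note int_bump = integrable_bounded_mult[OF f(1) continuous_bump[OF h] bump_bound]
    define P where "P = (LINT \<tau>|lebesgue_on ?I. f \<tau> * of_real (bump h s \<tau>))"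
    define Q where "Q = (LINT \<tau>|lebesgue_on ?I. f \<tau> * of_real (bump h t \<tau>))"
    define R where "R = (LINT \<tau>|lebesgue_on ?I. g \<tau> * of_real (\<psi> \<tau>))"
    have "(LINT \<tau>|lebesgue_on ?I. f \<tau> * of_real (deriv \<psi> \<tau>)) = - R"
      using weak test unfolding weak_deriv_on_def R_def by (auto simp: deriv)
    moreover have "(LINT \<tau>|lebesgue_on ?I. f \<tau> * of_real (deriv \<psi> \<tau>)) = P - Q"
      unfolding deriv of_real_diff right_diff_distrib P_def Q_def
      by (rule Bochner_Integration.integral_diff[OF int_bump int_bump])
    ultimately have PQ: "P - Q = - R" by simp
    have P: "cmod (P - f s) \<le> e * B"
      unfolding P_def by (rule bump_average_close[OF h _ f(2) B(2)]) (use st hle h d1 in auto)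
    have Q: "cmod (Q - f t) \<le> e * B"
      unfolding Q_def by (rule bump_average_close[OF h _ f(2) B(2)]) (use st hle h d2 in auto)
    have R: "cmod R \<le> C * (t + h - s)"
    proof -
      have c\<psi>: "continuous_on UNIV \<psi>"
        by (meson DERIV_isCont continuous_at_imp_continuous_on smooth smooth_functions_deriv'(2))
      have int: "integrable (lebesgue_on ?I) (\<lambda>\<tau>. g \<tau> * of_real (\<psi> \<tau>))"
        by (rule integrable_bounded_mult[OF g c\<psi> abs1])
      have sub: "{s..t + h} \<subseteq> ?I" using st hle by auto
      have meas_ind: "{s..t + h} \<inter> ?I = {s..t + h}" using sub by auto
      have fin: "emeasure (lebesgue_on ?I) {s..t + h} = emeasure lebesgue {s..t + h}"
        by (rule emeasure_restrict_space) (use sub in auto)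
      have "{s..t + h} \<in> sets (lebesgue_on ?I)" using sub by (simp add: sets_restrict_space_iff)
      then have int2: "integrable (lebesgue_on ?I) (\<lambda>\<tau>. C * indicator {s..t + h} \<tau>)"
        by (intro integrable_mult_right integrable_real_indicator) (auto simp: fin emeasure_lborel_Icc_eq)
      have "cmod R \<le> (LINT \<tau>|lebesgue_on ?I. cmod (g \<tau> * of_real (\<psi> \<tau>)))"
        unfolding R_def by (rule integral_norm_bound)
      also have "\<dots> \<le> (LINT \<tau>|lebesgue_on ?I. C * indicator {s..t + h} \<tau>)"
      proof (rule integral_mono_AE[OF integrable_norm[OF int] int2])
        show "AE \<tau> in lebesgue_on ?I. cmod (g \<tau> * of_real (\<psi> \<tau>)) \<le> C * indicator {s..t + h} \<tau>"
          using C
        proof eventually_elim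
          case (elim \<tau>)
          have "cmod (g \<tau>) * \<bar>\<psi> \<tau>\<bar> \<le> C * 1"
            using elim abs1[of \<tau>] C_nonneg by (intro mult_mono) auto
          then show ?case using supp[of \<tau>] by (cases "\<tau> \<in> {s..t + h}") (auto simp: norm_mult)
        qed
      qed
      also have "\<dots> = C * (t + h - s)"
        using st h fin by (simp add: measure_def meas_ind emeasure_lborel_Icc_eq)
      finally show ?thesis .
    qed
    have split: "f s - f t = - R - (P - f s) + (Q - f t)" using PQ by (simp add: algebra_simps)
    have "cmod (f s - f t) \<le> cmod R + cmod (P - f s) + cmod (Q - f t)"
      using norm_triangle_ineq[of "- R - (P - f s)" "Q - f t"] norm_triangle_ineq4[of "- R" "P - f s"]
      unfolding split norm_minus_cancel by linarith
    also have "\<dots> \<le> C * (t + h - s) + e * B + e * B" using P Q R by linarith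
    also have "\<dots> \<le> C * (t - s) + \<epsilon>" using Ch e(2) by (simp add: algebra_simps)
    finally show "cmod (f s - f t) \<le> C * (t - s) + \<epsilon>" .
  qed
  have "C-lipschitz_on ?I f"
  proof (rule lipschitz_onI)
    fix s t assume "s \<in> ?I" "t \<in> ?I"
    then show "dist (f s) (f t) \<le> C * dist s t"
      using main[of s t] main[of t s] by (cases s t rule: linorder_cases) (auto simp: dist_norm norm_minus_commute)
  qed (rule C_nonneg)
  then show thesis using that by blast
qed

section \<open>Energy of the growing and decaying modes\<close>

text \<open>With \<open>z = k s\<close> and \<open>v = p y'\<close>, the functions \<open>v + z y\<close> and \<open>v - z y\<close> are, to leading order for large \<open>k\<close>,
the exponentially growing and decaying modes of the equation; the energy compares their sizes.\<close>

definition energy :: "real \<Rightarrow> complex \<Rightarrow> complex \<Rightarrow> complex \<Rightarrow> real" where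
  "energy K z y v = (cmod (v + z * y))\<^sup>2 - K * (cmod (v - z * y))\<^sup>2"

lemma two_variable_square_bounds:
  fixes p q :: real
  shows "p * q \<le> (p\<^sup>2 + q\<^sup>2) / 2" "(p + q)\<^sup>2 \<le> 2 * p\<^sup>2 + 2 * q\<^sup>2"
  using sum_squares_bound[of p q] by (auto simp: power2_sum)

text \<open>When \<open>s\<close> jumps from \<open>s1\<close> to \<open>s2\<close> while \<open>y\<close> and \<open>v\<close> are continuous, the new modes are \<open>\<alpha> U + \<beta> V\<close> and
\<open>\<beta> U + \<alpha> V\<close>, with transmission coefficient \<open>\<alpha>\<close> proportional to \<open>s1 + s2\<close>. As \<open>\<alpha>\<close> does not vanish, the
growing mode is transmitted. The reflected parts are harmless once the decaying mode has
a large weight before the jump and a small one after it.\<close>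

lemma energy_interface:
  assumes "s1 \<noteq> 0" "s1 + s2 \<noteq> 0"
  obtains K0 \<delta> Kmin :: real where "K0 > 0" "\<delta> > 0" "K0 \<le> Kmin"
    "\<And>K1 k y v. K1 \<ge> Kmin \<Longrightarrow> \<delta> * energy K1 (k * s1) y v \<le> energy K0 (k * s2) y v"
proof -
  define \<alpha> where "\<alpha> = (s1 + s2) / (2 * s1)"
  define \<beta> where "\<beta> = (s1 - s2) / (2 * s1)"
  define A where "A = (cmod \<alpha>)\<^sup>2"
  define B where "B = (cmod \<beta>)\<^sup>2"
  have A: "A > 0" using assms by (simp add: A_def \<alpha>_def)
  have B: "B \<ge> 0" by (simp add: B_def)
  \<comment> \<open>the reflected growing mode, of size \<open>B\<close>, then costs at most half of the transmitted \<open>A / 2\<close>\<close>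
  define K0 where "K0 = A / (8 * (B + 1))"
  have K0: "K0 > 0" "2 * K0 * B \<le> A / 4" using A B by (auto simp: K0_def field_simps)
  define Kmin where "Kmin = max K0 (4 * (B + 2 * K0 * A) / A)"
  show thesis
  proof (rule that[of K0 "A / 4" Kmin])
    fix K1 k y v assume K1: "K1 \<ge> Kmin"
    define U where "U = v + k * s1 * y"
    define V where "V = v - k * s1 * y"
    have new: "v + k * s2 * y = \<alpha> * U + \<beta> * V" "v - k * s2 * y = \<beta> * U + \<alpha> * V"
      using assms by (auto simp: \<alpha>_def \<beta>_def U_def V_def field_simps)
    have "cmod (\<alpha> * U) \<le> cmod (\<alpha> * U + \<beta> * V) + cmod (\<beta> * V)"
      by (metis norm_triangle_ineq4 add_diff_cancel)
    then have "(cmod (\<alpha> * U))\<^sup>2 \<le> (cmod (\<alpha> * U + \<beta> * V) + cmod (\<beta> * V))\<^sup>2"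
      by (intro power_mono) auto
    also have "\<dots> \<le> 2 * (cmod (\<alpha> * U + \<beta> * V))\<^sup>2 + 2 * (cmod (\<beta> * V))\<^sup>2"
      by (rule two_variable_square_bounds)
    finally have 1: "(cmod (\<alpha> * U + \<beta> * V))\<^sup>2 \<ge> A * (cmod U)\<^sup>2 / 2 - B * (cmod V)\<^sup>2"
      by (simp add: A_def B_def norm_mult power_mult_distrib)
    have "(cmod (\<beta> * U + \<alpha> * V))\<^sup>2 \<le> (cmod (\<beta> * U) + cmod (\<alpha> * V))\<^sup>2"
      by (intro power_mono norm_triangle_ineq) auto
    also have "\<dots> \<le> 2 * (cmod (\<beta> * U))\<^sup>2 + 2 * (cmod (\<alpha> * V))\<^sup>2"
      by (rule two_variable_square_bounds)
    finally have 2: "(cmod (\<beta> * U + \<alpha> * V))\<^sup>2 \<le> 2 * (B * (cmod U)\<^sup>2) + 2 * (A * (cmod V)\<^sup>2)"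
      by (simp add: A_def B_def norm_mult power_mult_distrib)
    have 3: "K0 * (cmod (\<beta> * U + \<alpha> * V))\<^sup>2 \<le> K0 * (2 * (B * (cmod U)\<^sup>2) + 2 * (A * (cmod V)\<^sup>2))"
      using K0(1) by (intro mult_left_mono[OF 2]) auto
    have 4: "2 * K0 * B * (cmod U)\<^sup>2 \<le> A / 4 * (cmod U)\<^sup>2" using K0(2) by (intro mult_right_mono) auto
    have "4 * (B + 2 * K0 * A) \<le> K1 * A"
      using K1 A by (simp add: Kmin_def pos_divide_le_eq)
    then have "B + 2 * K0 * A \<le> A / 4 * K1" by (simp add: mult.commute)
    then have 5: "(B + 2 * K0 * A) * (cmod V)\<^sup>2 \<le> A / 4 * K1 * (cmod V)\<^sup>2"
      by (rule mult_right_mono) simp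
    show "A / 4 * energy K1 (k * s1) y v \<le> energy K0 (k * s2) y v"
      unfolding energy_def new U_def[symmetric] V_def[symmetric]
      using 1 3 4 5 by (simp add: algebra_simps)
  qed (use A K0 in \<open>auto simp: Kmin_def\<close>)
qed

lemma approx_deriv_const: "approx_deriv (\<lambda>_. C) t 0 0"
  by (rule has_vector_derivative_imp_approx_deriv) simp

lemmas approx_deriv_mult = approx_deriv_bilinear[OF bounded_bilinear_mult norm_mult_ineq]

lemma approx_deriv_norm_square:
  fixes f :: "real \<Rightarrow> complex"
  assumes "approx_deriv f t D B"
  shows "approx_deriv (\<lambda>x. (cmod (f x))\<^sup>2) t (2 * (f t \<bullet> D)) (2 * cmod (f t) * B)"
proof -
  have "approx_deriv (\<lambda>x. f x \<bullet> f x) t (D \<bullet> f t + f t \<bullet> D) (B * norm (f t) + norm (f t) * B)"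
    by (rule approx_deriv_bilinear[OF bounded_bilinear_inner _ assms assms])
       (simp add: Cauchy_Schwarz_ineq2)
  then show ?thesis by (simp add: power2_norm_eq_inner inner_commute mult_ac)
qed

text \<open>If \<open>S\<close> were differentiable, the modes would satisfy \<open>U' = k R U + (q + k S') y\<close> and
\<open>V' = - k R V + (q - k S') y\<close>. Here \<open>k S' y\<close> enters as a tolerance \<open>e \<le> \<bar>k\<bar> L \<bar>y\<bar>\<close>, and since
\<open>2 k S y = U - V\<close>, it is bounded by \<open>U\<close> and \<open>V\<close> independently of \<open>k\<close>, as is \<open>q y\<close>. The main terms contribute
\<open>2 R Re k (\<bar>U\<bar>\<^sup>2 + K \<bar>V\<bar>\<^sup>2)\<close>, half of which absorbs the perturbations and the variation of the weight
when \<open>Re k\<close> is large.\<close>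

lemma energy_approx_deriv:
  fixes S y v :: "real \<Rightarrow> complex" and k :: complex
  assumes y: "(y has_vector_derivative y') (at t)" and v: "(v has_vector_derivative v') (at t)"
    and S: "L-lipschitz_on {c..d} S" and t: "c < t" "t < d"
    and eq1: "S t * y' = of_real R * v t" and eq2: "v' = (qt + k\<^sup>2 * (S t * of_real R)) * y t"
    and qt: "cmod qt \<le> C" and s0: "s0 > 0" "s0 \<le> cmod (S t)" and r0: "r0 > 0" "r0 \<le> R"
    and K: "(K has_real_derivative K') (at t)" "0 < K0" "K0 \<le> K t" "K t \<le> K1" "0 \<le> K'"
    and k: "cmod k \<ge> 1"
    and large: "2 * ((C + L) / s0) * (1 + K1) + K' \<le> Re k * r0 * min 1 K0"
  shows "\<exists>E B. approx_deriv (\<lambda>t. energy (K t) (k * S t) (y t) (v t)) t E B \<and>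
    Re k * r0 * ((cmod (v t + k * S t * y t))\<^sup>2 + K t * (cmod (v t - k * S t * y t))\<^sup>2) \<le> E - B"
proof -
  define U where "U = v t + k * S t * y t"
  define V where "V = v t - k * S t * y t"
  define e where "e = cmod k * (L * cmod (y t))"
  have L: "L \<ge> 0" using lipschitz_on_nonneg[OF S] .
  have C: "C \<ge> 0" using qt norm_ge_zero order_trans by blast
  have e0: "e \<ge> 0" using L by (simp add: e_def)
  note ay = has_vector_derivative_imp_approx_deriv[OF y]
  note av = has_vector_derivative_imp_approx_deriv[OF v]
  note aS = lipschitz_imp_approx_deriv[OF S t]
  have "approx_deriv (\<lambda>t. k * (S t * y t)) t
     (0 * (S t * y t) + k * (0 * y t + S t * y')) (0 * norm (S t * y t) + norm k * (L * norm (y t) + norm (S t) * 0))"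
    by (rule approx_deriv_mult[OF approx_deriv_const approx_deriv_mult[OF aS ay]])
  then have aW: "approx_deriv (\<lambda>t. k * (S t * y t)) t (k * (of_real R * v t)) e"
    by (simp add: eq1 e_def)
  have "approx_deriv (\<lambda>t. v t + k * (S t * y t)) t (v' + k * (of_real R * v t)) (0 + e)"
    by (rule approx_deriv_add[OF av aW])
  moreover have "v' + k * (of_real R * v t) = qt * y t + of_real R * (k * U)"
    by (simp add: eq2 U_def algebra_simps power2_eq_square)
  ultimately have aU: "approx_deriv (\<lambda>t. v t + k * S t * y t) t (qt * y t + of_real R * (k * U)) e"
    by (simp add: mult.assoc)
  have "approx_deriv (\<lambda>t. v t - k * (S t * y t)) t (v' - k * (of_real R * v t)) (0 + e)"
    by (rule approx_deriv_diff[OF av aW])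
  moreover have "v' - k * (of_real R * v t) = qt * y t - of_real R * (k * V)"
    by (simp add: eq2 V_def algebra_simps power2_eq_square)
  ultimately have aV: "approx_deriv (\<lambda>t. v t - k * S t * y t) t (qt * y t - of_real R * (k * V)) e"
    by (simp add: mult.assoc)
  have aK: "approx_deriv K t K' 0"
    using K(1) by (intro has_vector_derivative_imp_approx_deriv)
      (simp add: has_real_derivative_iff_has_vector_derivative)
  define E where "E = 2 * (U \<bullet> (qt * y t + of_real R * (k * U)))
      - (K' * (cmod V)\<^sup>2 + K t * (2 * (V \<bullet> (qt * y t - of_real R * (k * V)))))"
  define B where "B = 2 * cmod U * e + K t * (2 * cmod V * e)"
  have "approx_deriv (\<lambda>t. energy (K t) (k * S t) (y t) (v t)) t E B"
    using approx_deriv_diff[OF approx_deriv_norm_square[OF aU] approx_deriv_mult[OF aK approx_deriv_norm_square[OF aV]]]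
      K(2,3)
    by (simp add: energy_def[abs_def] E_def B_def U_def V_def)
  moreover have "Re k * r0 * ((cmod U)\<^sup>2 + K t * (cmod V)\<^sup>2) \<le> E - B"
  proof -
    let ?u = "cmod U" and ?v = "cmod V"
    let ?M = "(C + L) / s0"
    define z where "z = (?u + ?v) / (2 * s0)"
    have uv: "?u \<ge> 0" "?v \<ge> 0" by auto
    have z0: "z \<ge> 0" using s0 by (simp add: z_def)
    have M0: "?M \<ge> 0" using C L s0 by simp
    have Kt: "K t > 0" using K by linarith
    have ky: "cmod k * cmod (y t) \<le> z"
    proof -
      have "2 * (cmod k * cmod (S t) * cmod (y t)) = cmod (U - V)"
        by (simp add: U_def V_def norm_mult)
      also have "\<dots> \<le> ?u + ?v" by (rule norm_triangle_ineq4)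
      finally have "2 * (cmod k * cmod (S t) * cmod (y t)) \<le> ?u + ?v" .
      moreover have "2 * (cmod k * s0 * cmod (y t)) \<le> 2 * (cmod k * cmod (S t) * cmod (y t))"
        using s0 by (intro mult_left_mono mult_right_mono) auto
      ultimately show ?thesis using s0(1) by (simp add: z_def field_simps)
    qed
    have yz: "cmod (y t) \<le> z"
    proof -
      have "1 * cmod (y t) \<le> cmod k * cmod (y t)" using k by (intro mult_right_mono) auto
      then show ?thesis using ky by simp
    qed
    have ez: "e \<le> L * z"
      using mult_left_mono[OF ky L] by (simp add: e_def mult_ac)
    have qz: "cmod (qt * y t) \<le> C * z"
      using qt yz C by (auto simp: norm_mult intro!: mult_mono)
    have inn: "X \<bullet> (of_real R * (k * X)) = R * Re k * (cmod X)\<^sup>2" for X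
      unfolding cmod_power2 inner_complex_def by (simp add: algebra_simps power2_eq_square)
    have "\<bar>U \<bullet> (qt * y t)\<bar> \<le> ?u * (C * z)"
      using Cauchy_Schwarz_ineq2[of U "qt * y t"] mult_left_mono[OF qz uv(1)] by linarith
    then have iU: "U \<bullet> (qt * y t) \<ge> - (?u * (C * z))" by linarith
    have "\<bar>V \<bullet> (qt * y t)\<bar> \<le> ?v * (C * z)"
      using Cauchy_Schwarz_ineq2[of V "qt * y t"] mult_left_mono[OF qz uv(2)] by linarith
    then have iV: "K t * (V \<bullet> (qt * y t)) \<le> K t * (?v * (C * z))"
      using Kt by (intro mult_left_mono) auto
    have eU: "?u * e \<le> ?u * (L * z)" using ez by (intro mult_left_mono) auto
    have eV: "K t * (?v * e) \<le> K t * (?v * (L * z))" using ez Kt by (intro mult_left_mono) auto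
    have cross: "x * (2 * (C + L) * z) \<le> 2 * ?M * (?u\<^sup>2 + ?v\<^sup>2)" if "x = ?u \<or> x = ?v" for x
    proof -
      have "x * (?u + ?v) \<le> 2 * (?u\<^sup>2 + ?v\<^sup>2)"
      proof -
        have "?u * ?v \<le> (?u\<^sup>2 + ?v\<^sup>2) / 2" by (rule two_variable_square_bounds)
        moreover have "x * (?u + ?v) = ?u\<^sup>2 + ?u * ?v \<or> x * (?u + ?v) = ?v\<^sup>2 + ?u * ?v"
          using that by (elim disjE) (simp_all add: algebra_simps power2_eq_square)
        moreover have "0 \<le> ?u\<^sup>2" "0 \<le> ?v\<^sup>2" by simp_all
        moreover have "X \<le> 2 * (p + q)" if "m \<le> (p + q) / 2" "X = p + m \<or> X = q + m" "0 \<le> p" "0 \<le> q"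
          for X p q m :: real using that by auto
        ultimately show ?thesis by blast
      qed
      then have "?M * (x * (?u + ?v)) \<le> ?M * (2 * (?u\<^sup>2 + ?v\<^sup>2))" using M0 by (intro mult_left_mono)
      moreover have "?M * (x * (?u + ?v)) = x * (2 * (C + L) * z)"
        using s0(1) by (simp add: z_def field_simps)
      ultimately show ?thesis by (simp only: mult.assoc mult.left_commute)
    qed
    have cV: "K t * (?v * (2 * (C + L) * z)) \<le> K1 * (2 * ?M * (?u\<^sup>2 + ?v\<^sup>2))"
    proof -
      have "K t * (?v * (2 * (C + L) * z)) \<le> K t * (2 * ?M * (?u\<^sup>2 + ?v\<^sup>2))"
        by (rule mult_left_mono[OF cross less_imp_le[OF Kt]]) simp
      also have "\<dots> \<le> K1 * (2 * ?M * (?u\<^sup>2 + ?v\<^sup>2))"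
        by (intro mult_right_mono[OF K(4)] mult_nonneg_nonneg M0 add_nonneg_nonneg zero_le_power2) simp
      finally show ?thesis .
    qed
    have "E - B = 2 * (R * Re k) * (?u\<^sup>2 + K t * ?v\<^sup>2) + 2 * (U \<bullet> (qt * y t)) - 2 * (K t * (V \<bullet> (qt * y t)))
       - 2 * (?u * e) - 2 * (K t * (?v * e)) - K' * ?v\<^sup>2"
      unfolding E_def B_def inner_add_right inner_diff_right inn by (simp add: algebra_simps)
    also have "\<dots> \<ge> 2 * (R * Re k) * (?u\<^sup>2 + K t * ?v\<^sup>2) - 2 * (?u * (C * z)) - 2 * (K t * (?v * (C * z)))
       - 2 * (?u * (L * z)) - 2 * (K t * (?v * (L * z))) - K' * ?v\<^sup>2"
      using iU iV eU eV by linarith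
    finally have lower: "E - B \<ge> 2 * (R * Re k) * (?u\<^sup>2 + K t * ?v\<^sup>2)
        - ?u * (2 * (C + L) * z) - K t * (?v * (2 * (C + L) * z)) - K' * ?v\<^sup>2"
      by (simp add: algebra_simps)
    let ?P = "?u\<^sup>2 + K t * ?v\<^sup>2"
    have P0: "?P \<ge> 0" using Kt by simp
    have Rek: "Re k \<ge> 0"
    proof -
      have "0 \<le> Re k * (r0 * min 1 K0)"
      proof -
        have "0 \<le> 2 * ?M * (1 + K1)" by (intro mult_nonneg_nonneg M0) (use K in auto)
        then show ?thesis using large K(5) unfolding mult.assoc by linarith
      qed
      moreover have "r0 * min 1 K0 > 0" using r0 K by simp
      ultimately show ?thesis by (simp add: zero_le_mult_iff)
    qed
    have "r0 * Re k \<le> R * Re k" using r0 Rek by (intro mult_right_mono)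
    then have "2 * (r0 * Re k) * ?P \<le> 2 * (R * Re k) * ?P" using P0 by (intro mult_right_mono) auto
    moreover have "(2 * ?M * (1 + K1) + K') * (?u\<^sup>2 + ?v\<^sup>2) \<le> (Re k * r0 * min 1 K0) * (?u\<^sup>2 + ?v\<^sup>2)"
      by (rule mult_right_mono[OF large]) simp
    moreover have "(Re k * r0) * (min 1 K0 * (?u\<^sup>2 + ?v\<^sup>2)) \<le> (Re k * r0) * ?P"
    proof (rule mult_left_mono)
      have "min 1 K0 * ?u\<^sup>2 \<le> 1 * ?u\<^sup>2" by (intro mult_right_mono) auto
      moreover have "min 1 K0 * ?v\<^sup>2 \<le> K t * ?v\<^sup>2" using K(3) by (intro mult_right_mono) auto
      ultimately show "min 1 K0 * (?u\<^sup>2 + ?v\<^sup>2) \<le> ?P" by (simp add: distrib_left)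
    qed (use Rek r0 in simp)
    moreover have "K' * ?v\<^sup>2 \<le> K' * (?u\<^sup>2 + ?v\<^sup>2)" using K(5) by (intro mult_left_mono) auto
    moreover have "(2 * ?M * (1 + K1) + K') * (?u\<^sup>2 + ?v\<^sup>2) =
      2 * ?M * (?u\<^sup>2 + ?v\<^sup>2) + K1 * (2 * ?M * (?u\<^sup>2 + ?v\<^sup>2)) + K' * (?u\<^sup>2 + ?v\<^sup>2)"
      by (simp only: distrib_left distrib_right mult_1_right mult_1_left mult.assoc mult.left_commute)
    moreover have "(Re k * r0) * (min 1 K0 * (?u\<^sup>2 + ?v\<^sup>2)) = (Re k * r0 * min 1 K0) * (?u\<^sup>2 + ?v\<^sup>2)"
      by (simp only: mult.assoc)
    moreover have "2 * (r0 * Re k) * ?P = 2 * ((Re k * r0) * ?P)" by (simp only: mult_ac)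
    ultimately show "Re k * r0 * ?P \<le> E - B" using lower cross[of ?u] cV by linarith
  qed
  ultimately show ?thesis unfolding U_def V_def by blast
qed

lemma energy_bounded: 
  assumes "K \<ge> 0"
  shows "\<bar>energy K z y v\<bar> \<le> (cmod (v + z * y))\<^sup>2 + K * (cmod (v - z * y))\<^sup>2"
  using assms mult_nonneg_nonneg[OF assms zero_le_power2[of "cmod (v - z * y)"]]
  by (simp add: energy_def abs_le_iff)

text \<open>On a piece where \<open>p\<close>, \<open>w\<close> are regular put \<open>S = p r\<close>, with \<open>R = r\<close>. Then \<open>S R = w\<close>, and \<open>p y' = v\<close> becomes
\<open>S y' = R v\<close>, so that the system with \<open>\<mu> = - k\<^sup>2\<close> can be written with \<open>S\<close> and \<open>R\<close> alone; \<open>qt\<close> is the value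
of the potential.\<close>

definition piece_solution ::
    "real \<Rightarrow> real \<Rightarrow> (real \<Rightarrow> complex) \<Rightarrow> (real \<Rightarrow> real) \<Rightarrow> real \<Rightarrow> complex \<Rightarrow> (real \<Rightarrow> complex) \<Rightarrow> (real \<Rightarrow> complex) \<Rightarrow> bool"
  where "piece_solution c d S R C k y v \<longleftrightarrow>
    absolutely_continuous_on c d y \<and> absolutely_continuous_on c d v \<and>
    (\<exists>N. negligible N \<and> (\<forall>t. c < t \<longrightarrow> t < d \<longrightarrow> t \<notin> N \<longrightarrow> (\<exists>y' qt.
       (y has_vector_derivative y') (at t) \<and>
       (v has_vector_derivative (qt + k\<^sup>2 * (S t * of_real (R t))) * y t) (at t) \<and>
       S t * y' = of_real (R t) * v t \<and> cmod qt \<le> C)))"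

lemma absolutely_continuous_on_norm_square:
  fixes f :: "real \<Rightarrow> complex"
  assumes "absolutely_continuous_on a b f"
  shows "absolutely_continuous_on a b (\<lambda>t. (cmod (f t))\<^sup>2)"
  unfolding power2_norm_eq_inner
  by (rule absolutely_continuous_on_bilinear[OF bounded_bilinear_inner _ assms assms]) (simp add: Cauchy_Schwarz_ineq2)

lemmas absolutely_continuous_on_mult = absolutely_continuous_on_bilinear[OF bounded_bilinear_mult norm_mult_ineq]

text \<open>The weight is interpolated linearly between \<open>K0\<close> and \<open>K1\<close>. The energy then increases at a rate of at least
\<open>Re k r0\<close> times \<open>\<bar>U\<bar>\<^sup>2 + K \<bar>V\<bar>\<^sup>2\<close>, which is at least its own absolute value. So positive energy is multiplied
by a large factor from left to right, and negative energy from right to left. Energy that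
vanishes throughout leaves no room for growth, which forces \<open>U = V = 0\<close>.\<close>

lemma energy_on_piece:
  assumes cd: "c < d" and S: "L-lipschitz_on {c..d} S" and s0: "s0 > 0" "\<And>t. t \<in> {c..d} \<Longrightarrow> s0 \<le> cmod (S t)"
    and r0: "r0 > 0" "\<And>t. \<lbrakk>c < t; t < d\<rbrakk> \<Longrightarrow> r0 \<le> R t" and K: "0 < K0" "K0 \<le> K1"
    and k: "Re k \<ge> 1" and large: "2 * ((C + L) / s0) * (1 + K1) + (K1 - K0) / (d - c) \<le> Re k * r0 * min 1 K0"
    and sol: "piece_solution c d S R C k y v"
  defines "Q0 \<equiv> energy K0 (k * S c) (y c) (v c)" and "Q1 \<equiv> energy K1 (k * S d) (y d) (v d)"
  shows "Q0 \<ge> 0 \<Longrightarrow> (1 + Re k * r0 * (d - c)) * Q0 \<le> Q1"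
    and "Q1 \<le> 0 \<Longrightarrow> Q0 \<le> (1 + Re k * r0 * (d - c)) * Q1"
    and "\<lbrakk>Q0 \<ge> 0; Q1 = 0; t \<in> {c..d}\<rbrakk> \<Longrightarrow> y t = 0"
proof -
  define K where "K t = K0 + (K1 - K0) / (d - c) * (t - c)" for t
  define Q where "Q t = energy (K t) (k * S t) (y t) (v t)" for t
  define P where "P t = (cmod (v t + k * S t * y t))\<^sup>2 + K t * (cmod (v t - k * S t * y t))\<^sup>2" for t
  let ?\<rho> = "Re k * r0"
  have slope: "(K1 - K0) / (d - c) \<ge> 0" using cd K by simp
  have K_ends: "K c = K0" "K d = K1" using cd by (auto simp: K_def)
  have K_bounds: "K0 \<le> K t" "K t \<le> K1" if "t \<in> {c..d}" for t
  proof -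
    show "K0 \<le> K t" using mult_nonneg_nonneg[OF slope, of "t - c"] that by (simp add: K_def)
    have "(K1 - K0) / (d - c) * (t - c) \<le> (K1 - K0) / (d - c) * (d - c)"
      using that slope by (intro mult_left_mono) auto
    then show "K t \<le> K1" using cd by (simp add: K_def)
  qed
  have QP: "\<bar>Q t\<bar> \<le> P t" if "t \<in> {c..d}" for t
    unfolding Q_def P_def using K_bounds[OF that] K by (intro energy_bounded) linarith
  have \<rho>: "?\<rho> > 0" using k r0 by simp
  have ACy: "absolutely_continuous_on c d y" and ACv: "absolutely_continuous_on c d v"
    using sol by (auto simp: piece_solution_def)
  have ACK: "absolutely_continuous_on c d K"
  proof (rule lipschitz_imp_absolutely_continuous)
    show "((K1 - K0) / (d - c))-lipschitz_on {c..d} K"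
    proof (rule lipschitz_onI)
      fix s t
      have "K0 + \<sigma> * (s - c) - (K0 + \<sigma> * (t - c)) = \<sigma> * (s - t)" for \<sigma> by (simp add: algebra_simps)
      then have "K s - K t = (K1 - K0) / (d - c) * (s - t)" unfolding K_def .
      then show "dist (K s) (K t) \<le> (K1 - K0) / (d - c) * dist s t"
        using slope by (simp only: dist_real_def abs_mult abs_of_nonneg)
    qed (rule slope)
  qed
  have ACW: "absolutely_continuous_on c d (\<lambda>t. k * S t * y t)"
  proof -
    have "0-lipschitz_on {c..d} (\<lambda>_. k)" by (rule lipschitz_on_constant)
    from absolutely_continuous_on_mult[OF lipschitz_imp_absolutely_continuous[OF this] lipschitz_imp_absolutely_continuous[OF S]]
    show ?thesis by (rule absolutely_continuous_on_mult[OF _ ACy])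
  qed
  note ACU = absolutely_continuous_on_norm_square[OF absolutely_continuous_on_add[OF ACv ACW]]
  note ACV = absolutely_continuous_on_mult[OF ACK absolutely_continuous_on_norm_square[OF absolutely_continuous_on_diff[OF ACv ACW]]]
  have ACQ: "absolutely_continuous_on c d Q"
    unfolding Q_def energy_def by (rule absolutely_continuous_on_diff[OF ACU ACV])
  have contP: "continuous_on {c..d} P"
    unfolding P_def by (rule absolutely_continuous_imp_continuous[OF absolutely_continuous_on_add[OF ACU ACV]])
  obtain N where N: "negligible N" and ode: "\<And>t. \<lbrakk>c < t; t < d; t \<notin> N\<rbrakk> \<Longrightarrow> \<exists>y' qt.
       (y has_vector_derivative y') (at t) \<and>
       (v has_vector_derivative (qt + k\<^sup>2 * (S t * of_real (R t))) * y t) (at t) \<and>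
       S t * y' = of_real (R t) * v t \<and> cmod qt \<le> C"
    using sol unfolding piece_solution_def by blast
  have rate: "\<exists>E B. approx_deriv Q t E B \<and> ?\<rho> * P t \<le> E - B" if t: "c < t" "t < d" "t \<notin> N" for t
  proof -
    obtain y' qt where o: "(y has_vector_derivative y') (at t)"
       "(v has_vector_derivative (qt + k\<^sup>2 * (S t * of_real (R t))) * y t) (at t)"
       "S t * y' = of_real (R t) * v t" "cmod qt \<le> C"
      using ode[OF t] by blast
    have tcd: "t \<in> {c..d}" using t by simp
    have dK: "(K has_real_derivative (K1 - K0) / (d - c)) (at t)"
      unfolding K_def using cd by (auto intro!: derivative_eq_intros)
    have "cmod k \<ge> 1" using k complex_Re_le_cmod[of k] by linarith
    from energy_approx_deriv[OF o(1,2) S t(1,2) o(3) refl o(4) s0(1) s0(2)[OF tcd] r0(1) r0(2)[OF t(1,2)]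
      dK K(1) K_bounds[OF tcd] slope this large]
    show ?thesis unfolding Q_def P_def .
  qed
  have growth: "D * (t - s) \<le> Q t - Q s"
    if st: "c \<le> s" "s \<le> t" "t \<le> d" and D: "\<And>\<tau>. \<tau> \<in> {s..t} \<Longrightarrow> D \<le> ?\<rho> * P \<tau>" for D s t
  proof (rule absolutely_continuous_mean_value[OF absolutely_continuous_on_subset[OF ACQ st(1,3)] st(2) N])
    fix \<tau> assume \<tau>: "s < \<tau>" "\<tau> < t" "\<tau> \<notin> N"
    then obtain E B where "approx_deriv Q \<tau> E B" "?\<rho> * P \<tau> \<le> E - B" using rate[of \<tau>] st by auto
    then show "\<exists>E B. approx_deriv Q \<tau> E B \<and> D \<le> E - B" using D[of \<tau>] \<tau> by (metis atLeastAtMost_iff less_imp_le order_trans)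
  qed
  have mono: "Q s \<le> Q t" if "c \<le> s" "s \<le> t" "t \<le> d" for s t
  proof -
    have "0 \<le> ?\<rho> * P \<tau>" if "\<tau> \<in> {s..t}" for \<tau>
      using QP[of \<tau>] that \<open>c \<le> s\<close> \<open>t \<le> d\<close> by (intro mult_nonneg_nonneg[OF less_imp_le[OF \<rho>]]) auto
    from growth[OF that this] show ?thesis by simp
  qed
  have ends: "Q c = Q0" "Q d = Q1" by (auto simp: Q_def K_ends Q0_def Q1_def)
  show "(1 + ?\<rho> * (d - c)) * Q0 \<le> Q1" if "Q0 \<ge> 0"
  proof -
    have "?\<rho> * Q0 * (d - c) \<le> Q d - Q c"
    proof (rule growth)
      fix \<tau> assume \<tau>: "\<tau> \<in> {c..d}"
      show "?\<rho> * Q0 \<le> ?\<rho> * P \<tau>"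
        using QP[OF \<tau>] mono[of c \<tau>] \<tau> \<rho> ends by (intro mult_left_mono) auto
    qed (use cd in auto)
    then show ?thesis by (simp add: ends algebra_simps)
  qed
  show "Q0 \<le> (1 + ?\<rho> * (d - c)) * Q1" if "Q1 \<le> 0"
  proof -
    have "?\<rho> * (- Q1) * (d - c) \<le> Q d - Q c"
    proof (rule growth)
      fix \<tau> assume \<tau>: "\<tau> \<in> {c..d}"
      show "?\<rho> * (- Q1) \<le> ?\<rho> * P \<tau>"
        using QP[OF \<tau>] mono[of \<tau> d] \<tau> \<rho> ends by (intro mult_left_mono) auto
    qed (use cd in auto)
    then show ?thesis by (simp add: ends algebra_simps)
  qed
  show "y t = 0" if "Q0 \<ge> 0" "Q1 = 0" and t: "t \<in> {c..d}"
  proof (rule ccontr)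
    assume "y t \<noteq> 0"
    have Q_zero: "Q s = 0" if "s \<in> {c..d}" for s
      using mono[of c s] mono[of s d] that \<open>Q0 \<ge> 0\<close> \<open>Q1 = 0\<close> ends by simp
    have Pt: "P t > 0"
    proof -
      have "S t \<noteq> 0" using s0 t by force
      moreover have "k \<noteq> 0" using k by force
      moreover have "(v t + k * S t * y t) - (v t - k * S t * y t) = 2 * (k * S t * y t)" by simp
      ultimately have "v t + k * S t * y t \<noteq> 0 \<or> v t - k * S t * y t \<noteq> 0"
        using \<open>y t \<noteq> 0\<close> by (metis diff_zero mult_eq_0_iff zero_neq_numeral)
      moreover have "K t > 0" using K_bounds[OF t] K by linarith
      ultimately show ?thesis unfolding P_def
        by (elim disjE) (simp_all add: add_pos_nonneg add_nonneg_pos del: right_minus_eq)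
    qed
    then obtain \<epsilon> where \<epsilon>: "\<epsilon> > 0" "\<And>s. s \<in> {c..d} \<Longrightarrow> dist s t < \<epsilon> \<Longrightarrow> dist (P s) (P t) < P t / 2"
      using contP t unfolding continuous_on_iff by (metis half_gt_zero)
    define l where "l = max c (t - \<epsilon> / 2)"
    define h where "h = min d (t + \<epsilon> / 2)"
    have lh: "c \<le> l" "l < h" "h \<le> d" "t - \<epsilon> < l" "h < t + \<epsilon>"
      using t cd \<epsilon>(1) by (auto simp: l_def h_def)
    have "(?\<rho> * (P t / 2)) * (h - l) \<le> Q h - Q l"
    proof (rule growth)
      fix \<tau> assume \<tau>: "\<tau> \<in> {l..h}"
      then have "dist (P \<tau>) (P t) < P t / 2" using lh by (intro \<epsilon>(2)) (auto simp: dist_real_def)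
      then have "P t / 2 \<le> P \<tau>" unfolding dist_real_def by linarith
      then show "?\<rho> * (P t / 2) \<le> ?\<rho> * P \<tau>" using \<rho> by (intro mult_left_mono) auto
    qed (use lh in auto)
    also have "Q h - Q l = 0" using Q_zero lh by simp
    finally have "(?\<rho> * (P t / 2)) * (h - l) \<le> 0" .
    moreover have "(?\<rho> * (P t / 2)) * (h - l) > 0"
      using Pt lh by (intro mult_pos_pos[OF mult_pos_pos[OF \<rho>]]) auto
    ultimately show False by linarith
  qed
qed

text \<open>Interface followed by piece, for a fixed weight \<open>K\<close> of the decaying mode in front of every interface. The
factor \<open>\<delta>\<close> at the interface is fixed, while the factor \<open>G\<close> on the piece grows with \<open>Re k\<close>. The
maximum expresses both cases at once: positive energy at least doubles, and negative energy is at least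
halved in size. A single \<open>K\<close> must serve for all interfaces, and \<open>Re k\<close> must be large depending on \<open>K\<close>; hence
the two nested quantifiers.\<close>

lemma energy_step:
  assumes cd: "c < d" and S: "L-lipschitz_on {c..d} S" and s0: "s0 > 0" "\<And>t. t \<in> {c..d} \<Longrightarrow> s0 \<le> cmod (S t)"
    and r0: "r0 > 0" "\<And>t. \<lbrakk>c < t; t < d\<rbrakk> \<Longrightarrow> r0 \<le> R t"
    and s: "s \<noteq> 0" "s + S c \<noteq> 0"
  shows "\<forall>\<^sub>F K in at_top. \<forall>\<^sub>F \<kappa> in at_top. \<forall>k y v. Re k = \<kappa> \<longrightarrow> piece_solution c d S R C k y v \<longrightarrow>
    (let X = energy K (k * s) (y c) (v c); X' = energy K (k * S d) (y d) (v d)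
     in max (2 * X) (X / 2) \<le> X' \<and> (X = 0 \<longrightarrow> X' = 0 \<longrightarrow> (\<forall>t\<in>{c..d}. y t = 0)))"
proof -
  obtain K0 \<delta> Kmin :: real where K0: "K0 > 0" "K0 \<le> Kmin" and \<delta>: "\<delta> > 0"
    and jump: "\<And>K1 k y v. K1 \<ge> Kmin \<Longrightarrow> \<delta> * energy K1 (k * s) y v \<le> energy K0 (k * S c) y v"
    using energy_interface[OF s] by metis
  show ?thesis
    unfolding eventually_at_top_linorder[of "\<lambda>K. \<forall>\<^sub>F \<kappa> in at_top. _ K \<kappa>"]
  proof (intro exI[of _ Kmin] allI impI)
    fix K1 assume K1: "K1 \<ge> Kmin"
    define A where "A = 2 * ((C + L) / s0) * (1 + K1) + (K1 - K0) / (d - c)"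
    \<comment> \<open>\<open>G \<delta> \<ge> 2\<close> doubles positive energy, and \<open>\<delta> / G \<le> 1 / 2\<close> halves negative energy\<close>
    have "\<forall>\<^sub>F \<kappa> in at_top. \<kappa> \<ge> 1 \<and> \<kappa> \<ge> A / (r0 * min 1 K0) \<and> \<kappa> \<ge> max (2 / \<delta>) (2 * \<delta>) / (r0 * (d - c))"
      by (intro eventually_conj eventually_ge_at_top)
    then show "\<forall>\<^sub>F \<kappa> in at_top. \<forall>k y v. Re k = \<kappa> \<longrightarrow> piece_solution c d S R C k y v \<longrightarrow>
      (let X = energy K1 (k * s) (y c) (v c); X' = energy K1 (k * S d) (y d) (v d)
       in max (2 * X) (X / 2) \<le> X' \<and> (X = 0 \<longrightarrow> X' = 0 \<longrightarrow> (\<forall>t\<in>{c..d}. y t = 0)))"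
    proof eventually_elim
      case (elim \<kappa>)
      show ?case
      proof (intro allI impI)
        fix k y v assume k: "Re k = \<kappa>" and sol: "piece_solution c d S R C k y v"
        define X where "X = energy K1 (k * s) (y c) (v c)"
        define X' where "X' = energy K1 (k * S d) (y d) (v d)"
        define Q0 where "Q0 = energy K0 (k * S c) (y c) (v c)"
        define G where "G = 1 + Re k * r0 * (d - c)"
        have "r0 * min 1 K0 > 0" "r0 * (d - c) > 0" using r0(1) K0(1) cd by auto
        then have large: "A \<le> Re k * r0 * min 1 K0" and "max (2 / \<delta>) (2 * \<delta>) \<le> Re k * r0 * (d - c)"
          using elim k by (simp_all only: pos_divide_le_eq mult.assoc)
        then have G: "2 / \<delta> \<le> G" "2 * \<delta> \<le> G" by (auto simp: G_def)
        have G0: "G > 0" using G(2) \<delta> by linarith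
        have "Re k \<ge> 1" using elim k by simp
        note piece = energy_on_piece[OF cd S s0 r0 K0(1) order_trans[OF K0(2) K1] this large[unfolded A_def] sol]
        have X_Q0: "\<delta> * X \<le> Q0" unfolding X_def Q0_def by (rule jump[OF K1])
        have "max (2 * X) (X / 2) \<le> X'"
        proof (cases "X \<ge> 0")
          case True
          then have "0 \<le> \<delta> * X" using \<delta> by simp
          then have "G * Q0 \<le> X'" using piece(1) X_Q0 unfolding X'_def Q0_def G_def by linarith
          moreover have "2 * X \<le> G * \<delta> * X"
            using G(1) \<delta> True by (intro mult_right_mono) (auto simp: pos_divide_le_eq)
          moreover have "G * (\<delta> * X) \<le> G * Q0" using X_Q0 G0 by (intro mult_left_mono) auto
          ultimately have "2 * X \<le> X'" by (simp add: mult.assoc)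
          then show ?thesis using True by simp
        next
          case False
          show ?thesis
          proof (cases "X' \<le> 0")
            case True
            then have "\<delta> * X \<le> G * X'" using piece(2) X_Q0 unfolding X'_def Q0_def G_def by linarith
            moreover have "G * X / 2 \<le> \<delta> * X"
              using mult_right_mono_neg[OF G(2), of "X / 2"] False by simp
            ultimately have "G * (X / 2) \<le> G * X'" by simp
            then have "X / 2 \<le> X'" using G0 by (simp only: mult_le_cancel_left_pos)
            then show ?thesis using False by simp
          qed (use False in auto)
        qed
        moreover have "y t = 0" if "X = 0" "X' = 0" "t \<in> {c..d}" for t
          using piece(3)[of t] X_Q0 that unfolding X'_def Q0_def by simp
        ultimately show "let X = energy K1 (k * s) (y c) (v c); X' = energy K1 (k * S d) (y d) (v d)
          in max (2 * X) (X / 2) \<le> X' \<and> (X = 0 \<longrightarrow> X' = 0 \<longrightarrow> (\<forall>t\<in>{c..d}. y t = 0))"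
          by (simp add: Let_def X_def[symmetric] X'_def[symmetric])
      qed
    qed
  qed
qed

section \<open>Coefficients on one piece\<close>

text \<open>On the half-line \<open>[r0, \<infinity>)\<close> the square root is Lipschitz, since \<open>(r t)\<^sup>2 - (r u)\<^sup>2 = (r t - r u) (r t + r u)\<close>
with last factor at least \<open>2 r0\<close>; and \<open>r\<^sup>2 = w / p\<close> is a Lipschitz quotient with denominator bounded away from zero.\<close>

lemma lipschitz_quotient_root:
  fixes p w :: "real \<Rightarrow> complex" and r :: "real \<Rightarrow> real"
  assumes p: "L-lipschitz_on I p" "\<And>t. t \<in> I \<Longrightarrow> cmod (p t) \<le> P1" "p0 > 0" "\<And>t. t \<in> I \<Longrightarrow> p0 \<le> cmod (p t)"
    and w: "M-lipschitz_on I w" "\<And>t. t \<in> I \<Longrightarrow> cmod (w t) \<le> W1" "w0 > 0" "\<And>t. t \<in> I \<Longrightarrow> w0 \<le> cmod (w t)"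
    and r: "\<And>t. t \<in> I \<Longrightarrow> r t > 0" "\<And>t. t \<in> I \<Longrightarrow> w t / p t = of_real ((r t)\<^sup>2)"
  obtains r0 Lr R1 where "r0 > 0" "\<And>t. t \<in> I \<Longrightarrow> r0 \<le> r t" "\<And>t. t \<in> I \<Longrightarrow> r t \<le> R1" "Lr-lipschitz_on I r"
proof (cases "I = {}")
  case True
  show thesis
    by (rule that[where ?r0.0 = 1 and ?Lr = 0]) (use True in \<open>auto simp: lipschitz_on_def\<close>)
next
  case False
  then obtain t0 where "t0 \<in> I" by blast
  then have P1: "P1 > 0" and W1: "W1 > 0" using p(2-4) w(2-4) by (meson less_le_trans order_trans)+
  have L: "L \<ge> 0" and M: "M \<ge> 0" using p(1) w(1) lipschitz_on_nonneg by blast+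
  have pn: "p t \<noteq> 0" if "t \<in> I" for t using p(3) p(4)[of t] that by force
  have r_sq: "(r t)\<^sup>2 = cmod (w t) / cmod (p t)" if "t \<in> I" for t
    using arg_cong[OF r(2)[OF that], of cmod] by (simp add: norm_divide norm_power)
  define r0 where "r0 = sqrt (w0 / P1)"
  have r0: "r0 > 0" using P1 w(3) by (simp add: r0_def)
  have low: "r0 \<le> r t" if t: "t \<in> I" for t
  proof -
    have "w0 / P1 \<le> (r t)\<^sup>2"
      unfolding r_sq[OF t] using p(2,4)[OF t] p(3) w(3) w(4)[OF t] by (intro frac_le) auto
    then show ?thesis unfolding r0_def using r(1)[OF t] by (simp add: real_sqrt_le_iff real_le_lsqrt)
  qed
  have up: "r t \<le> sqrt (W1 / p0)" if t: "t \<in> I" for t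
  proof -
    have "(r t)\<^sup>2 \<le> W1 / p0"
      unfolding r_sq[OF t] using p(3) p(4)[OF t] w(2)[OF t] W1 by (intro frac_le) auto
    then show ?thesis by (rule real_le_rsqrt)
  qed
  define Lr where "Lr = (M * P1 + W1 * L) / (p0 * p0) / (2 * r0)"
  have "Lr-lipschitz_on I r"
  proof (rule lipschitz_onI)
    show "Lr \<ge> 0" unfolding Lr_def using L M P1 W1 p(3) r0 by (intro divide_nonneg_nonneg add_nonneg_nonneg mult_nonneg_nonneg) auto
    fix t u assume t: "t \<in> I" and u: "u \<in> I"
    have "w t * p u - w u * p t = (w t - w u) * p u - w u * (p t - p u)" by (simp add: algebra_simps)
    then have "cmod (w t * p u - w u * p t) \<le> cmod ((w t - w u) * p u) + cmod (w u * (p t - p u))"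
      by (simp only: norm_triangle_ineq4)
    also have "\<dots> \<le> (M * dist t u) * P1 + W1 * (L * dist t u)"
      unfolding norm_mult using lipschitz_onD[OF p(1) t u] lipschitz_onD[OF w(1) t u] p(2)[OF u] w(2)[OF u] M L W1
      by (intro add_mono mult_mono) (auto simp: dist_norm)
    finally have num: "cmod (w t * p u - w u * p t) \<le> (M * P1 + W1 * L) * dist t u"
      by (simp add: algebra_simps)
    have "complex_of_real ((r t)\<^sup>2 - (r u)\<^sup>2) = (w t * p u - w u * p t) / (p t * p u)"
      using r(2)[OF t] r(2)[OF u] pn[OF t] pn[OF u] by (simp add: diff_frac_eq[symmetric])
    then have "\<bar>(r t)\<^sup>2 - (r u)\<^sup>2\<bar> = cmod (w t * p u - w u * p t) / (cmod (p t) * cmod (p u))"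
      by (metis norm_divide norm_mult norm_of_real)
    also have "\<dots> \<le> ((M * P1 + W1 * L) * dist t u) / (p0 * p0)"
      using num p(3,4) t u by (intro frac_le mult_mono) (auto intro: order_trans[OF norm_ge_zero num])
    finally have sq: "\<bar>(r t)\<^sup>2 - (r u)\<^sup>2\<bar> \<le> (M * P1 + W1 * L) / (p0 * p0) * dist t u" by simp
    have "\<bar>r t - r u\<bar> * (2 * r0) \<le> \<bar>r t - r u\<bar> * (r t + r u)"
      using low[OF t] low[OF u] by (intro mult_left_mono) auto
    also have "\<dots> = \<bar>(r t)\<^sup>2 - (r u)\<^sup>2\<bar>"
      using r(1)[OF t] r(1)[OF u] by (simp add: power2_eq_square square_diff_square_factored abs_mult mult.commute)
    finally have "\<bar>r t - r u\<bar> * (2 * r0) \<le> (M * P1 + W1 * L) / (p0 * p0) * dist t u" using sq by linarith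
    then have "\<bar>r t - r u\<bar> \<le> ((M * P1 + W1 * L) / (p0 * p0) * dist t u) / (2 * r0)"
      using r0 by (subst pos_le_divide_eq) auto
    then show "dist (r t) (r u) \<le> Lr * dist t u"
      unfolding Lr_def dist_real_def[of "r t"] by (simp only: times_divide_eq_left)
  qed
  with r0 low up show thesis by (rule that)
qed

lemma closure_rep_lower_bound:
  fixes f :: "real \<Rightarrow> complex"
  assumes f: "continuous_on {a<..<b} f" and inf: "(INF t\<in>closure {a<..<b}. cmod (closure_rep {a<..<b} f t)) > 0"
    and t: "t \<in> {a<..<b}"
  shows "(INF t\<in>closure {a<..<b}. cmod (closure_rep {a<..<b} f t)) \<le> cmod (f t)"
proof -
  have "(INF t\<in>closure {a<..<b}. cmod (closure_rep {a<..<b} f t)) \<le> cmod (closure_rep {a<..<b} f t)"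
    by (rule cINF_lower) (use t closure_subset in \<open>auto intro!: bdd_belowI[of _ 0]\<close>)
  also have "closure_rep {a<..<b} f t = f t"
    unfolding closure_rep_def
  proof (rule tendsto_Lim)
    show "at t within {a<..<b} \<noteq> bot"
      using t at_within_open[of t "{a<..<b}"] by simp
    show "(f \<longlongrightarrow> f t) (at t within {a<..<b})"
      using f t by (auto simp: continuous_on_def)
  qed
  finally show ?thesis .
qed

text \<open>The impedance \<open>s = p r\<close> determines the modes on a piece. The estimates there use its Lipschitz
continuity and its distance from zero up to the end points, together with a lower bound for the growth
rate \<open>r\<close>.\<close>

lemma impedance_extension:
  fixes p w :: "real \<Rightarrow> complex" and r :: "real \<Rightarrow> real"
  assumes ab: "a < b"
    and p: "sobolev_inf_on 2 {a<..<b} p" "continuous_on {a<..<b} p"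
      "(INF t\<in>closure {a<..<b}. cmod (closure_rep {a<..<b} p t)) > 0"
    and w: "sobolev_inf_on 2 {a<..<b} w" "continuous_on {a<..<b} w"
      "(INF t\<in>closure {a<..<b}. cmod (closure_rep {a<..<b} w t)) > 0"
    and r: "\<And>t. t \<in> {a<..<b} \<Longrightarrow> r t > 0" "\<And>t. t \<in> {a<..<b} \<Longrightarrow> w t / p t = of_real ((r t)\<^sup>2)"
  obtains S L s0 r0 where "L-lipschitz_on {a..b} S" "s0 > 0" "\<And>t. t \<in> {a..b} \<Longrightarrow> s0 \<le> cmod (S t)"
    "r0 > 0" "\<And>t. t \<in> {a<..<b} \<Longrightarrow> r0 \<le> r t" "\<And>t. t \<in> {a<..<b} \<Longrightarrow> S t = p t * of_real (r t)"
    "\<And>t. t \<in> {a<..<b} \<Longrightarrow> p t \<noteq> 0"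
proof -
  let ?I = "{a<..<b}"
  have lip: "\<exists>L. L-lipschitz_on ?I f" if f: "sobolev_inf_on 2 ?I f" "continuous_on ?I f" for f
  proof -
    note f1 = f(1)[unfolded sobolev_inf_on_def]
    note Linf = conjunct1[OF f1]
    have "1 \<in> {1..2::nat}" by simp
    from bspec[OF conjunct2[OF f1] this] obtain g where g: "Linf_on ?I g" "weak_deriv_on 1 ?I f g" by blast
    obtain L where "L-lipschitz_on ?I f" by (rule weak_deriv_imp_lipschitz[OF Linf f(2) g])
    then show ?thesis ..
  qed
  obtain Lp Lw where Lp: "Lp-lipschitz_on ?I p" and Lw: "Lw-lipschitz_on ?I w"
    using lip p(1,2) w(1,2) by blast
  have bdd: "\<exists>B. \<forall>t\<in>?I. cmod (f t) \<le> B" if "L-lipschitz_on ?I f" for f :: "real \<Rightarrow> complex" and L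
  proof -
    have "bounded (f ` ?I)"
      by (rule bounded_uniformly_continuous_image[OF lipschitz_on_uniformly_continuous[OF that]]) simp
    then show ?thesis by (auto simp: bounded_iff)
  qed
  obtain P1 W1 where P1: "\<And>t. t \<in> ?I \<Longrightarrow> cmod (p t) \<le> P1" and W1: "\<And>t. t \<in> ?I \<Longrightarrow> cmod (w t) \<le> W1"
    using bdd[OF Lp] bdd[OF Lw] by blast
  note plow = closure_rep_lower_bound[OF p(2,3)]
  note wlow = closure_rep_lower_bound[OF w(2,3)]
  define p0 where "p0 = (INF t\<in>closure ?I. cmod (closure_rep ?I p t))"
  have p0: "p0 > 0" "\<And>t. t \<in> ?I \<Longrightarrow> p0 \<le> cmod (p t)" using p(3) plow by (auto simp: p0_def)
  obtain r0 Lr R1 where r0: "r0 > 0" "\<And>t. t \<in> ?I \<Longrightarrow> r0 \<le> r t" and R1: "\<And>t. t \<in> ?I \<Longrightarrow> r t \<le> R1"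
    and Lr: "Lr-lipschitz_on ?I r"
    by (rule lipschitz_quotient_root[OF Lp P1 p0 Lw W1 w(3) wlow r]) (assumption | rule that)+
  define s where "s t = p t * of_real (r t)" for t
  have mid: "(a + b) / 2 \<in> ?I" using ab by simp
  have P1_pos: "P1 > 0" using P1[OF mid] p0(1) p0(2)[OF mid] by linarith
  have R1_pos: "R1 > 0" using R1[OF mid] r(1)[OF mid] by linarith
  have "(Lp * R1 + P1 * Lr)-lipschitz_on ?I s"
  proof (rule lipschitz_onI)
    show "Lp * R1 + P1 * Lr \<ge> 0"
      using lipschitz_on_nonneg[OF Lp] lipschitz_on_nonneg[OF Lr] P1_pos R1_pos by simp
    fix t u assume t: "t \<in> ?I" and u: "u \<in> ?I"
    have "s t - s u = (p t - p u) * of_real (r t) + p u * of_real (r t - r u)"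
      by (simp add: s_def algebra_simps)
    then have "cmod (s t - s u) \<le> cmod (p t - p u) * cmod (of_real (r t)) + cmod (p u) * cmod (of_real (r t - r u))"
      by (metis norm_mult norm_triangle_ineq)
    also have "\<dots> \<le> (Lp * dist t u) * R1 + P1 * (Lr * dist t u)"
      using lipschitz_onD[OF Lp t u] lipschitz_onD[OF Lr t u] P1[OF u] R1[OF t] r(1)[OF t] P1_pos
        lipschitz_on_nonneg[OF Lp]
      unfolding norm_of_real dist_real_def[of "r t"] dist_norm[of "p t"]
      by (intro add_mono mult_mono) auto
    finally show "dist (s t) (s u) \<le> (Lp * R1 + P1 * Lr) * dist t u"
      by (simp add: dist_norm algebra_simps)
  qed
  from lipschitz_extend_closure[OF this] obtain S where
    S: "(Lp * R1 + P1 * Lr)-lipschitz_on {a..b} S" "\<And>t. t \<in> ?I \<Longrightarrow> S t = s t"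
    using ab by auto
  have low: "p0 * r0 \<le> cmod (S t)" if "t \<in> {a..b}" for t
  proof (rule continuous_ge_on_closure[where f = "\<lambda>t. cmod (S t)" and S = ?I])
    show "continuous_on (closure ?I) (\<lambda>t. cmod (S t))"
      using lipschitz_on_continuous_on[OF S(1)] ab by (auto intro: continuous_on_norm)
    show "t \<in> closure ?I" using that ab by simp
    fix u assume u: "u \<in> ?I"
    have "p0 * r0 \<le> cmod (p u) * r u" using p0 r0 u by (intro mult_mono) auto
    then show "p0 * r0 \<le> cmod (S u)" using u r(1)[OF u] by (simp add: S(2) s_def norm_mult)
  qed
  show thesis
  proof (rule that)
    show "(Lp * R1 + P1 * Lr)-lipschitz_on {a..b} S" by (rule S(1))
    show "p0 * r0 > 0" using p0 r0 by simp
    show "p0 * r0 \<le> cmod (S t)" if "t \<in> {a..b}" for t using that by (rule low)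
    show "r0 > 0" by (rule r0(1))
    show "r0 \<le> r t" if "t \<in> ?I" for t using that by (rule r0(2))
    show "S t = p t * of_real (r t)" if "t \<in> ?I" for t using S(2)[OF that] by (simp add: s_def)
    show "p t \<noteq> 0" if "t \<in> ?I" for t using p0(1) p0(2)[OF that] by force
  qed
qed

lemma Lim_at_right_interval:
  fixes S f :: "real \<Rightarrow> complex"
  assumes "a < b" "continuous_on {a..b} S" "\<And>t. t \<in> {a<..<b} \<Longrightarrow> f t = S t"
  shows "(f \<longlongrightarrow> S a) (at_right a)"
  by (rule Lim_transform_eventually[OF continuous_on_Icc_at_rightD[OF assms(2,1)]])
     (use eventually_at_right_real[OF assms(1)] assms(3) in \<open>auto elim: eventually_mono\<close>)

lemma Lim_at_left_interval:
  fixes S f :: "real \<Rightarrow> complex"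
  assumes "a < b" "continuous_on {a..b} S" "\<And>t. t \<in> {a<..<b} \<Longrightarrow> f t = S t"
  shows "(f \<longlongrightarrow> S b) (at_left b)"
  by (rule Lim_transform_eventually[OF continuous_on_Icc_at_leftD[OF assms(2,1)]])
     (use eventually_at_left_real[OF assms(1)] assms(3) in \<open>auto elim: eventually_mono\<close>)

lemma tendsto_at_right_periodic:
  fixes f :: "real \<Rightarrow> complex"
  assumes "\<And>t. f (t + d) = f t" "(f \<longlongrightarrow> l) (at_right a)"
  shows "(f \<longlongrightarrow> l) (at_right (a + d))"
proof -
  have "filterlim (\<lambda>t. t - d) (at_right a) (at_right (a + d))"
    unfolding filterlim_def filtermap_at_right_shift by simp
  from filterlim_compose[OF assms(2) this] have "((\<lambda>t. f (t - d)) \<longlongrightarrow> l) (at_right (a + d))" .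
  moreover have "f (t - d) = f t" for t using assms(1)[of "t - d"] by simp
  ultimately show ?thesis by simp
qed

section \<open>Eigenvalues in the left half-plane\<close>

text \<open>A quantity that at least doubles while positive and at least halves in size while negative cannot return to its initial value
unless it is zero.\<close>

lemma cyclic_growth_imp_zero:
  fixes X :: "nat \<Rightarrow> real"
  assumes step: "\<And>j. j < m \<Longrightarrow> max (2 * X j) (X j / 2) \<le> X (Suc j)" and cyc: "X m = X 0" and m: "m \<ge> 1"
    and j: "j \<le> m"
  shows "X j = 0"
proof -
  have ge: "X 0 \<le> X i" if "i \<le> m" for i
    using that
  proof (induction i)
    case (Suc i)
    then show ?case using step[of i] by (cases "X 0 \<ge> 0") auto
  qed simp
  obtain m' where m': "m = Suc m'" using m by (cases m) auto
  have X0: "X 0 = 0" using ge[of m'] step[of m'] cyc m' by auto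
  have "X j \<le> X i" if "j \<le> i" "i \<le> m" for i
    using that
  proof (induction i rule: dec_induct)
    case (step i)
    then show ?case using assms(1)[of i] ge[of i] X0 by auto
  qed simp
  from this[of m] ge[OF j] X0 cyc j show ?thesis by simp
qed

text \<open>The boundary condition multiplies both components of the state by a phase.\<close>

lemma energy_phase:
  assumes "cmod e = 1"
  shows "energy K z (e * y) (e * v) = energy K z y v"
proof -
  have "e * v + z * (e * y) = e * (v + z * y)" "e * v - z * (e * y) = e * (v - z * y)"
    by (simp_all add: algebra_simps)
  then show ?thesis using assms by (simp add: energy_def norm_mult)
qed

text \<open>\<open>- \<mu>\<close> lies in the right half-plane, so the argument of its square root is at most \<open>\<pi> / 4\<close> in absolute
value, and the real part of the root is comparable with its modulus.\<close>

lemma Re_csqrt_lower_bound: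
  assumes "Re \<mu> < 0" "cmod \<mu> \<ge> 2 * \<kappa>\<^sup>2" "\<kappa> \<ge> 0"
  shows "Re (csqrt (- \<mu>)) \<ge> \<kappa>"
proof -
  have "\<kappa>\<^sup>2 \<le> (cmod (- \<mu>) + Re (- \<mu>)) / 2" using assms by simp
  then have "\<kappa> \<le> sqrt ((cmod (- \<mu>) + Re (- \<mu>)) / 2)" by (rule real_le_rsqrt)
  then show ?thesis by simp
qed

lemma partition_mono:
  fixes x :: "nat \<Rightarrow> real"
  assumes "\<And>j. j < m \<Longrightarrow> x j < x (Suc j)" "i < j" "j \<le> m"
  shows "x i < x j"
  using assms(2,3)
proof (induction j)
  case (Suc j)
  show ?case
  proof (cases "i = j")
    case False
    then have "x i < x j" using Suc by simp
    also have "x j < x (Suc j)" using assms(1) Suc.prems by simp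
    finally show ?thesis .
  qed (use assms(1) Suc.prems in simp)
qed simp

lemma partition_cover:
  fixes x :: "nat \<Rightarrow> real"
  assumes "t \<in> {x 0..x m}" "m \<ge> 1"
  shows "\<exists>j<m. t \<in> {x j..x (Suc j)}"
  using assms
proof (induction m)
  case (Suc m)
  show ?case
  proof (cases "t \<le> x m \<and> m \<ge> 1")
    case True
    then show ?thesis using Suc by (auto simp: less_Suc_eq)
  next
    case False
    then have "t \<in> {x m..x (Suc m)}" using Suc.prems by (cases m) auto
    then show ?thesis by blast
  qed
qed simp

lemma eventually_csqrt_large:
  assumes "\<forall>\<^sub>F \<kappa> in at_top. \<forall>k. Re k = \<kappa> \<longrightarrow> P k"
  shows "\<exists>R0>0. \<forall>\<mu>. Re \<mu> < 0 \<and> cmod \<mu> \<ge> R0 \<longrightarrow> P (csqrt (- \<mu>))"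
proof -
  obtain \<kappa>0 where \<kappa>0: "\<And>\<kappa>. \<kappa> \<ge> \<kappa>0 \<Longrightarrow> \<forall>k. Re k = \<kappa> \<longrightarrow> P k"
    using assms by (auto simp: eventually_at_top_linorder)
  define \<kappa> where "\<kappa> = max \<kappa>0 1"
  show ?thesis
  proof (intro exI[of _ "2 * \<kappa>\<^sup>2"] conjI allI impI)
    show "2 * \<kappa>\<^sup>2 > 0" by (simp add: \<kappa>_def)
    fix \<mu> assume "Re \<mu> < 0 \<and> cmod \<mu> \<ge> 2 * \<kappa>\<^sup>2"
    then have "Re (csqrt (- \<mu>)) \<ge> \<kappa>" by (intro Re_csqrt_lower_bound) (auto simp: \<kappa>_def)
    then show "P (csqrt (- \<mu>))" using \<kappa>0[of "Re (csqrt (- \<mu>))"] by (simp add: \<kappa>_def)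
  qed
qed

theorem theorem3p1:
  fixes a b \<phi> :: real and m :: nat and x :: "nat \<Rightarrow> real" and \<Omega> :: "nat \<Rightarrow> real set"
    and p q w :: "real \<Rightarrow> complex" and r :: "real \<Rightarrow> real"
  assumes "m \<ge> 1" and "x 0 = a" and "x m = b" and "\<And>j. j < m \<Longrightarrow> x j < x (Suc j)"
    and "\<And>j. \<Omega> j = {x (j - 1)<..<x j}"
    and "\<And>t. p (t + (b - a)) = p t" and "\<And>t. q (t + (b - a)) = q t"
    and "\<And>t. w (t + (b - a)) = w t" and "\<And>t. r (t + (b - a)) = r t"
    and "\<And>j. j \<in> {1..m} \<Longrightarrow> sobolev_inf_on 2 (\<Omega> j) p \<and> continuous_on (\<Omega> j) p"
    and "\<And>j. j \<in> {1..m} \<Longrightarrow> sobolev_inf_on 2 (\<Omega> j) w \<and> continuous_on (\<Omega> j) w"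
    and "\<And>j. j \<in> {1..m} \<Longrightarrow> (INF t\<in>closure (\<Omega> j). cmod (closure_rep (\<Omega> j) p t)) > 0"
    and "\<And>j. j \<in> {1..m} \<Longrightarrow> (INF t\<in>closure (\<Omega> j). cmod (closure_rep (\<Omega> j) w t)) > 0"
    and "\<And>t. t \<in> {a..b} \<Longrightarrow> r t > 0"
    and "\<And>t. t \<in> {a..b} - x ` {0..m} \<Longrightarrow> w t / p t = of_real ((r t)\<^sup>2)"
    and "Linf_on {a..b} q"
    and "\<And>j. j \<in> {1..m} \<Longrightarrow>
           Lim (at_right (x j)) (\<lambda>t. p t * of_real (r t)) +
           Lim (at_left (x j)) (\<lambda>t. p t * of_real (r t)) \<noteq> 0"
  shows "\<exists>R0>0. \<forall>\<mu>. is_eigenvalue a b p q w \<phi> \<mu> \<and> Re \<mu> < 0 \<longrightarrow> cmod \<mu> < R0"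
proof -
  let ?s = "\<lambda>t. p t * complex_of_real (r t)"
  let ?I = "\<lambda>j. {x j<..<x (Suc j)}"
  have lt: "x i < x j" if "i < j" "j \<le> m" for i j by (rule partition_mono[of m x, OF assms(4) that])
  have le: "x i \<le> x j" if "i \<le> j" "j \<le> m" for i j
    using lt[of i j] that by (cases "i = j") auto
  have in_ab: "{x j..x (Suc j)} \<subseteq> {a..b}" if "j < m" for j
    using le[of 0 j] le[of "Suc j" m] that assms(2,3) by auto
  have off_partition: "t \<in> {a..b} - x ` {0..m}" if j: "j < m" and t: "t \<in> ?I j" for j t
  proof -
    have "t \<noteq> x i" if "i \<le> m" for i
    proof (cases "i \<le> j")
      case True
      then show ?thesis using le[of i j] j t by auto
    next
      case False
      then show ?thesis using le[of "Suc j" i] that t by auto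
    qed
    then have "t \<notin> x ` {0..m}" unfolding image_iff by simp
    moreover have "t \<in> {a..b}" using in_ab[OF j] t by (auto simp: subset_iff)
    ultimately show ?thesis by simp
  qed
  define coeffs where "coeffs j S L s0 r0 \<longleftrightarrow>
      L-lipschitz_on {x j..x (Suc j)} S \<and> s0 > 0 \<and> (\<forall>t\<in>{x j..x (Suc j)}. s0 \<le> cmod (S t)) \<and>
      r0 > 0 \<and> (\<forall>t\<in>?I j. r0 \<le> r t \<and> S t = ?s t \<and> p t \<noteq> 0)"
    for j S and L s0 r0 :: real
  have "\<exists>S L s0 r0. coeffs j S L s0 r0" if j: "j < m" for j
  proof -
    have Om: "\<Omega> (Suc j) = ?I j" using assms(5)[of "Suc j"] by simp
    have "Suc j \<in> {1..m}" using j by simp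
    note hyps = assms(10-13)[OF this, unfolded Om]
    have "r t > 0" "w t / p t = of_real ((r t)\<^sup>2)" if "t \<in> ?I j" for t
      using assms(14)[of t] assms(15)[of t] off_partition[OF j that] by auto
    from impedance_extension[OF assms(4)[OF j] conjunct1[OF hyps(1)] conjunct2[OF hyps(1)] hyps(3)
        conjunct1[OF hyps(2)] conjunct2[OF hyps(2)] hyps(4) this]
    obtain S L s0 r0 where "coeffs j S L s0 r0" unfolding coeffs_def by (metis (no_types, lifting))
    then show ?thesis by blast
  qed
  then obtain S :: "nat \<Rightarrow> real \<Rightarrow> complex" and L s0 r0 :: "nat \<Rightarrow> real" where
    coeffs: "\<And>j. j < m \<Longrightarrow> coeffs j (S j) (L j) (s0 j) (r0 j)"
    by metis
  have S: "(L j)-lipschitz_on {x j..x (Suc j)} (S j)" and s0: "s0 j > 0" "\<And>t. t \<in> {x j..x (Suc j)} \<Longrightarrow> s0 j \<le> cmod (S j t)"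
    and r0: "r0 j > 0" "\<And>t. t \<in> ?I j \<Longrightarrow> r0 j \<le> r t" and S_eq: "\<And>t. t \<in> ?I j \<Longrightarrow> S j t = ?s t"
    and p_nz: "\<And>t. t \<in> ?I j \<Longrightarrow> p t \<noteq> 0" if "j < m" for j
    using coeffs[OF that] unfolding coeffs_def by blast+
  have S_nz: "S j t \<noteq> 0" if "j < m" "t \<in> {x j..x (Suc j)}" for j t
    using s0(1)[OF that(1)] s0(2)[OF that] by force
  have S_cont: "continuous_on {x j..x (Suc j)} (S j)" if "j < m" for j
    by (rule lipschitz_on_continuous_on[OF S[OF that]])
  have right: "(?s \<longlongrightarrow> S j (x j)) (at_right (x j))" if "j < m" for j
    by (rule Lim_at_right_interval[OF assms(4)[OF that] S_cont[OF that]]) (use S_eq[OF that] in simp)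
  have left: "(?s \<longlongrightarrow> S j (x (Suc j))) (at_left (x (Suc j)))" if "j < m" for j
    by (rule Lim_at_left_interval[OF assms(4)[OF that] S_cont[OF that]]) (use S_eq[OF that] in simp)
  have right_b: "(?s \<longlongrightarrow> S 0 a) (at_right b)"
  proof -
    have "(?s \<longlongrightarrow> S 0 a) (at_right a)" using right[of 0] assms(1,2) by simp
    from tendsto_at_right_periodic[OF _ this, of "b - a"] show ?thesis using assms(6,9) by simp
  qed
  \<comment> \<open>the impedance on the left of \<open>x j\<close>; by periodicity the left neighbour of the first piece is the last one,
    so that the energies at \<open>a\<close> and at \<open>b\<close> are formed with the same impedance\<close>
  define \<sigma> where "\<sigma> j = (if j = 0 then S (m - 1) b else S (j - 1) (x j))" for j
  have \<sigma>_end: "\<sigma> m = \<sigma> 0" using assms(1,3) by (simp add: \<sigma>_def)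
  have no_cancel: "\<sigma> j \<noteq> 0 \<and> \<sigma> j + S j (x j) \<noteq> 0" if j: "j < m" for j
  proof (cases j)
    case 0
    have m1: "m - 1 < m" "Suc (m - 1) = m" using assms(1) by auto
    \<comment> \<open>periodic extension: the right limit at \<open>b\<close> is the one at \<open>a\<close>\<close>
    have "Lim (at_right b) ?s = S 0 a" by (rule tendsto_Lim[OF _ right_b]) simp
    moreover have "Lim (at_left b) ?s = S (m - 1) b"
      using left[OF m1(1)] unfolding m1(2) assms(3) by (intro tendsto_Lim) auto
    ultimately have "S (m - 1) b + S 0 a \<noteq> 0" using assms(17)[of m] assms(1,3) by (simp add: add.commute)
    moreover have "S (m - 1) b \<noteq> 0" by (rule S_nz[OF m1(1)]) (use assms(3) assms(4)[of "m - 1"] m1 in auto)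
    ultimately show ?thesis using 0 assms(2) by (simp add: \<sigma>_def)
  next
    case (Suc i)
    have i: "i < m" using j Suc by simp
    have "Lim (at_right (x j)) ?s = S j (x j)" by (rule tendsto_Lim[OF _ right[OF j]]) simp
    moreover have "Lim (at_left (x j)) ?s = S i (x j)"
      using left[OF i] unfolding Suc by (intro tendsto_Lim) auto
    ultimately have "S i (x j) + S j (x j) \<noteq> 0" using assms(17)[of j] j Suc by (simp add: add.commute)
    moreover have "S i (x j) \<noteq> 0" by (rule S_nz[OF i]) (use assms(4)[OF i] Suc in auto)
    ultimately show ?thesis using Suc by (simp add: \<sigma>_def)
  qed
  obtain C where C: "AE t in lebesgue_on {a..b}. cmod (q t) \<le> C"
    using assms(16) by (auto simp: Linf_on_def)
  define step where "step j K k y v \<longleftrightarrow>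
    (let X = energy K (k * \<sigma> j) (y (x j)) (v (x j)); X' = energy K (k * S j (x (Suc j))) (y (x (Suc j))) (v (x (Suc j)))
     in max (2 * X) (X / 2) \<le> X' \<and> (X = 0 \<longrightarrow> X' = 0 \<longrightarrow> (\<forall>t\<in>{x j..x (Suc j)}. y t = 0)))"
    for j K k and y v :: "real \<Rightarrow> complex"
  have "\<forall>\<^sub>F K in at_top. \<forall>\<^sub>F \<kappa> in at_top. \<forall>k y v. Re k = \<kappa> \<longrightarrow>
      piece_solution (x j) (x (Suc j)) (S j) r C k y v \<longrightarrow> step j K k y v" if j: "j < m" for j
    unfolding step_def
    by (rule energy_step[OF assms(4)[OF j] S[OF j] s0(1)[OF j] s0(2)[OF j] r0(1)[OF j] r0(2)[OF j]])
       (use no_cancel[OF j] in auto)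
  then have "\<forall>\<^sub>F K in at_top. \<forall>j\<in>{..<m}. \<forall>\<^sub>F \<kappa> in at_top. \<forall>k y v. Re k = \<kappa> \<longrightarrow>
      piece_solution (x j) (x (Suc j)) (S j) r C k y v \<longrightarrow> step j K k y v"
    by (intro eventually_ball_finite) auto
  then obtain K where "\<forall>j\<in>{..<m}. \<forall>\<^sub>F \<kappa> in at_top. \<forall>k y v. Re k = \<kappa> \<longrightarrow>
      piece_solution (x j) (x (Suc j)) (S j) r C k y v \<longrightarrow> step j K k y v"
    using eventually_happens'[OF trivial_limit_at_top_linorder] by blast
  then have "\<forall>\<^sub>F \<kappa> in at_top. \<forall>j\<in>{..<m}. \<forall>k y v. Re k = \<kappa> \<longrightarrow>
      piece_solution (x j) (x (Suc j)) (S j) r C k y v \<longrightarrow> step j K k y v"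
    by (intro eventually_ball_finite) auto
  then have "\<forall>\<^sub>F \<kappa> in at_top. \<forall>k. Re k = \<kappa> \<longrightarrow> (\<forall>j<m. \<forall>y v.
      piece_solution (x j) (x (Suc j)) (S j) r C k y v \<longrightarrow> step j K k y v)"
    by (rule eventually_mono) blast
  from eventually_csqrt_large[OF this] obtain R0 where R0: "R0 > 0" and
    large: "\<And>\<mu> j y v. \<lbrakk>Re \<mu> < 0; R0 \<le> cmod \<mu>; j < m;
      piece_solution (x j) (x (Suc j)) (S j) r C (csqrt (- \<mu>)) y v\<rbrakk> \<Longrightarrow> step j K (csqrt (- \<mu>)) y v"
    by blast
  have "cmod \<mu> < R0" if eig: "is_eigenvalue a b p q w \<phi> \<mu>" and neg: "Re \<mu> < 0" for \<mu>
  proof (rule ccontr)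
    assume "\<not> cmod \<mu> < R0"
    then have big: "R0 \<le> cmod \<mu>" by simp
    \<comment> \<open>the root with positive real part\<close>
    define k where "k = csqrt (- \<mu>)"
    have k: "k\<^sup>2 = - \<mu>" by (simp add: k_def)
    obtain y v where sol: "is_solution a b p q w \<mu> y v" and nontriv: "\<exists>t\<in>{a..b}. y t \<noteq> 0"
      and bc: "y b = exp (\<i> * of_real \<phi>) * y a" "v b = exp (\<i> * of_real \<phi>) * v a"
      using eig unfolding is_eigenvalue_def by blast
    have AC: "absolutely_continuous_on a b y" "absolutely_continuous_on a b v"
      using sol by (auto simp: is_solution_def)
    let ?P = "\<lambda>t. (\<exists>y' v'. (y has_vector_derivative y') (at t) \<and> v t = p t * y' \<and>
        (v has_vector_derivative v') (at t) \<and> - v' + q t * y t = \<mu> * w t * y t) \<and> cmod (q t) \<le> C"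
    have "AE t in lebesgue_on {a..b}. ?P t"
      using sol C unfolding is_solution_def by (auto intro: AE_conjI)
    then obtain N where N: "N \<in> null_sets (lebesgue_on {a..b})" "{t \<in> {a..b}. \<not> ?P t} \<subseteq> N"
      by (auto simp: eventually_ae_filter)
    have negl: "negligible N"
      using N(1) by (auto simp: negligible_iff_null_sets null_sets_restrict_space)
    have piece: "piece_solution (x j) (x (Suc j)) (S j) r C k y v" if j: "j < m" for j
      unfolding piece_solution_def
    proof (intro conjI exI[of _ N] allI impI negl)
      have ends: "a \<le> x j" "x (Suc j) \<le> b" using in_ab[OF j] assms(4)[OF j] by auto
      show "absolutely_continuous_on (x j) (x (Suc j)) y" "absolutely_continuous_on (x j) (x (Suc j)) v"
        using AC[THEN absolutely_continuous_on_subset[OF _ ends]] by auto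
      fix t assume t: "x j < t" "t < x (Suc j)" "t \<notin> N"
      then have tI: "t \<in> ?I j" by simp
      have tab: "t \<in> {a..b}" using in_ab[OF j] tI by (auto simp: subset_iff)
      have "?P t"
      proof (rule ccontr)
        assume "\<not> ?P t"
        with tab have "t \<in> {t \<in> {a..b}. \<not> ?P t}" by (simp only: mem_Collect_eq simp_thms)
        then show False using subsetD[OF N(2)] t(3) by blast
      qed
      then obtain y' v' where o: "(y has_vector_derivative y') (at t)" "v t = p t * y'"
        "(v has_vector_derivative v') (at t)" "- v' + q t * y t = \<mu> * w t * y t" "cmod (q t) \<le> C" by blast
      have "w t / p t = of_real ((r t)\<^sup>2)" by (rule assms(15)[OF off_partition[OF j tI]])
      then have w: "w t = ?s t * of_real (r t)"
        using p_nz[OF j tI] by (simp add: field_simps power2_eq_square)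
      have "v' = (q t + k\<^sup>2 * (S j t * of_real (r t))) * y t"
      proof -
        have "v' = q t * y t - \<mu> * w t * y t" using o(4) by (simp add: algebra_simps)
        then show ?thesis unfolding k S_eq[OF j tI] w[symmetric] by (simp add: algebra_simps)
      qed
      moreover have "S j t * y' = of_real (r t) * v t"
        unfolding S_eq[OF j tI] o(2) by (simp only: mult_ac)
      ultimately show "\<exists>y' qt. (y has_vector_derivative y') (at t) \<and>
         (v has_vector_derivative (qt + k\<^sup>2 * (S j t * of_real (r t))) * y t) (at t) \<and>
         S j t * y' = of_real (r t) * v t \<and> cmod qt \<le> C"
        using o(1,3,5) by blast
    qed
    \<comment> \<open>the energy just before the interface \<open>x j\<close>\<close>
    define X where "X j = energy K (k * \<sigma> j) (y (x j)) (v (x j))" for j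
    have steps: "max (2 * X j) (X j / 2) \<le> X (Suc j)"
      "X j = 0 \<Longrightarrow> X (Suc j) = 0 \<Longrightarrow> \<forall>t\<in>{x j..x (Suc j)}. y t = 0" if j: "j < m" for j
    proof -
      have st: "step j K k y v"
        using large[OF neg big j] piece[OF j] by (simp add: k_def)
      have XS: "X (Suc j) = energy K (k * S j (x (Suc j))) (y (x (Suc j))) (v (x (Suc j)))"
        by (simp add: X_def \<sigma>_def)
      have step: "max (2 * X j) (X j / 2) \<le> X (Suc j) \<and>
          (X j = 0 \<longrightarrow> X (Suc j) = 0 \<longrightarrow> (\<forall>t\<in>{x j..x (Suc j)}. y t = 0))"
        unfolding XS X_def[of j] by (rule st[unfolded step_def Let_def])
      show "max (2 * X j) (X j / 2) \<le> X (Suc j)" by (rule conjunct1[OF step])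
      show "\<forall>t\<in>{x j..x (Suc j)}. y t = 0" if "X j = 0" "X (Suc j) = 0"
        using conjunct2[OF step] that by (simp only: simp_thms)
    qed
    have "X m = X 0"
      unfolding X_def \<sigma>_end assms(2,3) bc by (rule energy_phase) simp
    then have zero: "X j = 0" if "j \<le> m" for j
      using cyclic_growth_imp_zero[of m X] steps(1) assms(1) that by blast
    have "y t = 0" if t: "t \<in> {a..b}" for t
    proof -
      obtain j where "j < m" "t \<in> {x j..x (Suc j)}"
        using partition_cover[of t x m] t assms(1-3) by auto
      then show ?thesis using steps(2)[of j] zero[of j] zero[of "Suc j"] by simp
    qed
    with nontriv show False by blast
  qed
  with R0 show ?thesis by blast
qed

end
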